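(* Let $p>1$, let $[X,\mathcal{B},m,\nu]$ be a reversible random walk space and let $\Omega\in\mathcal{B}$ be $m$-connected with $0<\nu(\Omega)<\nu(\Omega_m)<\infty$, and assume $\Omega$ satisfies a $p$-Poincaré inequality. Then $$\lambda_{m,p}(\Omega)\le\frac{\nu(\Omega)^{p-1}}{T_{m,p}(\Omega)}.$$
   Context: A random walk $m$ on a measurable space $(X,\mathcal{B})$ ($\mathcal{B}$ countably generated) is a family $(m_x)_{x\in X}$ of probability measures on $\mathcal{B}$ such that $x\mapsto m_x(B)$ is measurable for each $B\in\mathcal{B}$. A $\sigma$-finite measure $\nu$ on $X$ is reversible if $dm_x(y)d\nu(x)=dm_y(x)d\nu(y)$ as measures on $X\times X$; then $[X,\mathcal{B},m,\nu]$ is called a reversible random walk space. For $A,B\in\mathcal{B}$, $L_m(A,B):=\int_A m_x(B)\,d\nu(x)$. Notation: $d(\nu\otimes m_x)(x,y)=dm_x(y)\,d\nu(x)$ and $\nabla f(x,y):=f(y)-f(x)$. For $\Omega\in\mathcal{B}$: $\partial_m\Omega:=\{x\in X\setminus\Omega: m_x(\Omega)>0\}$ and $\Omega_m:=\Omega\cup\partial_m\Omega$. A set $\Omega\in\mathcal B$ with $\nu(\Omega)>0$ is $m$-connected if $L_m(A,B)>0$ for all measurable $A,B\subset\Omega$ of positive $\nu$-measure with $A\cup B=\Omega$. $L^p_0(\Omega_m,\nu):=\{f\in L^p(\Omega_m,\nu): f=0\ \nu\text{-a.e. on }\partial_m\Omega\}$. $\Omega$ satisfies a $p$-Poincaré inequality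 if there is $\lambda>0$ with $\lambda\int_\Omega|f|^pd\nu\le\int_{\Omega_m\times\Omega_m}|\nabla f(x,y)|^p\,d(\nu\otimes m_x)(x,y)$ for all $f\in L^p_0(\Omega_m,\nu)$. The $p$-torsional function $f_{\Omega,p}\in L_0^p(\Omega_m,\nu)$ is the unique (nonnegative) solution of $-\int_{\Omega_m}|f_{\Omega,p}(y)-f_{\Omega,p}(x)|^{p-2}(f_{\Omega,p}(y)-f_{\Omega,p}(x))\,dm_x(y)=1$ for $\nu$-a.e. $x\in\Omega$, $f_{\Omega,p}=0$ on $\partial_m\Omega$; and $T_{m,p}(\Omega):=\left(\int_\Omega f_{\Omega,p}\,d\nu\right)^{p-1}$. $$\lambda_{m,p}(\Omega):=\inf_{f\in L_0^p(\Omega_m,\nu)\setminus\{0\}}\frac{\frac12\int_{\Omega_m\times\Omega_m}|\nabla f(x,y)|^p\,d(\nu\otimes m_x)(x,y)}{\int_\Omega|f|^p\,d\nu}.$$ *)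

theory Defs
  imports "HOL-Probability.Probability"
begin

text \<open>
  The measurable space \<open>(X, \<B>)\<close> is carried by the measure \<open>\<nu>\<close>: \<open>X = space \<nu>\<close> and \<open>\<B> = sets \<nu>\<close>.
  Membership of \<open>m\<close> in \<open>\<nu> \<rightarrow>\<^sub>M prob_algebra \<nu>\<close> says that every \<open>m x\<close> is a probability measure
  on \<open>\<B>\<close> and that \<open>x \<mapsto> m x B\<close> is measurable for every \<open>B \<in> \<B>\<close>.
\<close>

definition countably_generated :: "'a measure \<Rightarrow> bool" where
  "countably_generated M \<longleftrightarrow>
     (\<exists>G. countable G \<and> G \<subseteq> Pow (space M) \<and> sets M = sigma_sets (space M) G)"

definition random_walk :: "'a measure \<Rightarrow> ('a \<Rightarrow> 'a measure) \<Rightarrow> bool" where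
  "random_walk M m \<longleftrightarrow> countably_generated M \<and> m \<in> M \<rightarrow>\<^sub>M prob_algebra M"

text \<open>The measure \<open>dm\<^sub>x(y) d\<nu>(x)\<close> on \<open>X \<times> X\<close>; see \<open>emeasure_walk_measure\<close> below.\<close>

definition walk_measure :: "'a measure \<Rightarrow> ('a \<Rightarrow> 'a measure) \<Rightarrow> ('a \<times> 'a) measure" where
  "walk_measure \<nu> m = \<nu> \<bind> (\<lambda>x. m x \<bind> (\<lambda>y. return (\<nu> \<Otimes>\<^sub>M \<nu>) (x, y)))"

definition reversible_random_walk_space :: "'a measure \<Rightarrow> ('a \<Rightarrow> 'a measure) \<Rightarrow> bool" where
  "reversible_random_walk_space \<nu> m \<longleftrightarrow>
     random_walk \<nu> m \<and> sigma_finite_measure \<nu> \<and>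
     distr (walk_measure \<nu> m) (\<nu> \<Otimes>\<^sub>M \<nu>) (\<lambda>(x, y). (y, x)) = walk_measure \<nu> m"

definition interaction :: "'a measure \<Rightarrow> ('a \<Rightarrow> 'a measure) \<Rightarrow> 'a set \<Rightarrow> 'a set \<Rightarrow> ennreal" where
  "interaction \<nu> m A B = (\<integral>\<^sup>+x\<in>A. emeasure (m x) B \<partial>\<nu>)"

definition m_boundary :: "'a measure \<Rightarrow> ('a \<Rightarrow> 'a measure) \<Rightarrow> 'a set \<Rightarrow> 'a set" where
  "m_boundary \<nu> m \<Omega> = {x \<in> space \<nu> - \<Omega>. emeasure (m x) \<Omega> > 0}"

definition m_closure :: "'a measure \<Rightarrow> ('a \<Rightarrow> 'a measure) \<Rightarrow> 'a set \<Rightarrow> 'a set" where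
  "m_closure \<nu> m \<Omega> = \<Omega> \<union> m_boundary \<nu> m \<Omega>"

definition m_connected :: "'a measure \<Rightarrow> ('a \<Rightarrow> 'a measure) \<Rightarrow> 'a set \<Rightarrow> bool" where
  "m_connected \<nu> m \<Omega> \<longleftrightarrow> \<Omega> \<in> sets \<nu> \<and> emeasure \<nu> \<Omega> > 0 \<and>
     (\<forall>A\<in>sets \<nu>. \<forall>B\<in>sets \<nu>. A \<union> B = \<Omega> \<longrightarrow> emeasure \<nu> A > 0 \<longrightarrow> emeasure \<nu> B > 0 \<longrightarrow>
        interaction \<nu> m A B > 0)"

text \<open>
  Elements of \<open>L\<^sup>p\<close> are represented by functions on the whole type; their values outside the set
  in question are irrelevant, and they are identified only up to \<open>\<nu>\<close>-null sets.
\<close>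

definition Lp_on :: "'a measure \<Rightarrow> real \<Rightarrow> 'a set \<Rightarrow> ('a \<Rightarrow> real) set" where
  "Lp_on \<nu> p S =
     {f. set_borel_measurable \<nu> S f \<and> set_integrable \<nu> S (\<lambda>x. \<bar>f x\<bar> powr p)}"

definition Lp0 :: "'a measure \<Rightarrow> ('a \<Rightarrow> 'a measure) \<Rightarrow> real \<Rightarrow> 'a set \<Rightarrow> ('a \<Rightarrow> real) set" where
  "Lp0 \<nu> m p \<Omega> =
     {f \<in> Lp_on \<nu> p (m_closure \<nu> m \<Omega>). AE x in \<nu>. x \<in> m_boundary \<nu> m \<Omega> \<longrightarrow> f x = 0}"

definition gradient_energy ::
  "'a measure \<Rightarrow> ('a \<Rightarrow> 'a measure) \<Rightarrow> real \<Rightarrow> 'a set \<Rightarrow> ('a \<Rightarrow> real) \<Rightarrow> ennreal" where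
  "gradient_energy \<nu> m p \<Omega> f =
     (\<integral>\<^sup>+z\<in>m_closure \<nu> m \<Omega> \<times> m_closure \<nu> m \<Omega>.
        ennreal (\<bar>f (snd z) - f (fst z)\<bar> powr p) \<partial>walk_measure \<nu> m)"

definition poincare_inequality ::
  "'a measure \<Rightarrow> ('a \<Rightarrow> 'a measure) \<Rightarrow> real \<Rightarrow> 'a set \<Rightarrow> bool" where
  "poincare_inequality \<nu> m p \<Omega> \<longleftrightarrow>
     (\<exists>c::real. c > 0 \<and> (\<forall>f\<in>Lp0 \<nu> m p \<Omega>.
        ennreal c * (\<integral>\<^sup>+x\<in>\<Omega>. ennreal (\<bar>f x\<bar> powr p) \<partial>\<nu>) \<le> gradient_energy \<nu> m p \<Omega> f))"

text \<open>
  Since \<open>0 powr a = 0\<close>, the integrand below vanishes where \<open>f y = f x\<close>, also for \<open>p < 2\<close>.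
\<close>

definition is_torsional ::
  "'a measure \<Rightarrow> ('a \<Rightarrow> 'a measure) \<Rightarrow> real \<Rightarrow> 'a set \<Rightarrow> ('a \<Rightarrow> real) \<Rightarrow> bool" where
  "is_torsional \<nu> m p \<Omega> f \<longleftrightarrow> f \<in> Lp0 \<nu> m p \<Omega> \<and>
     (AE x in \<nu>. x \<in> m_closure \<nu> m \<Omega> \<longrightarrow> 0 \<le> f x) \<and>
     (AE x in \<nu>. x \<in> \<Omega> \<longrightarrow>
        - (LINT y:m_closure \<nu> m \<Omega>|m x. \<bar>f y - f x\<bar> powr (p - 2) * (f y - f x)) = 1)"

text \<open>
  The solution is unique only up to \<open>\<nu>\<close>-null sets, hence a choice of representative instead of
  a definite description.
\<close>

definition torsional_function ::
  "'a measure \<Rightarrow> ('a \<Rightarrow> 'a measure) \<Rightarrow> real \<Rightarrow> 'a set \<Rightarrow> 'a \<Rightarrow> real" where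
  "torsional_function \<nu> m p \<Omega> = (SOME f. is_torsional \<nu> m p \<Omega> f)"

definition torsional_rigidity ::
  "'a measure \<Rightarrow> ('a \<Rightarrow> 'a measure) \<Rightarrow> real \<Rightarrow> 'a set \<Rightarrow> real" where
  "torsional_rigidity \<nu> m p \<Omega> = (LINT x:\<Omega>|\<nu>. torsional_function \<nu> m p \<Omega> x) powr (p - 1)"

definition dirichlet_eigenvalue ::
  "'a measure \<Rightarrow> ('a \<Rightarrow> 'a measure) \<Rightarrow> real \<Rightarrow> 'a set \<Rightarrow> ennreal" where
  "dirichlet_eigenvalue \<nu> m p \<Omega> =
     (INF f \<in> {f \<in> Lp0 \<nu> m p \<Omega>. \<not> (AE x in \<nu>. x \<in> m_closure \<nu> m \<Omega> \<longrightarrow> f x = 0)}.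
        (1 / 2 * gradient_energy \<nu> m p \<Omega> f) / (\<integral>\<^sup>+x\<in>\<Omega>. ennreal (\<bar>f x\<bar> powr p) \<partial>\<nu>))"

lemma emeasure_walk_measure:
  assumes m: "m \<in> \<nu> \<rightarrow>\<^sub>M prob_algebra \<nu>" and C: "C \<in> sets (\<nu> \<Otimes>\<^sub>M \<nu>)" and ne: "space \<nu> \<noteq> {}"
  shows "emeasure (walk_measure \<nu> m) C = (\<integral>\<^sup>+x. \<integral>\<^sup>+y. indicator C (x, y) \<partial>m x \<partial>\<nu>)"
proof -
  have m': "m \<in> \<nu> \<rightarrow>\<^sub>M subprob_algebra \<nu>"
    using m by (rule measurable_prob_algebraD)
  have k: "(\<lambda>x. m x \<bind> (\<lambda>y. return (\<nu> \<Otimes>\<^sub>M \<nu>) (x, y))) \<in> \<nu> \<rightarrow>\<^sub>M subprob_algebra (\<nu> \<Otimes>\<^sub>M \<nu>)"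
    by (rule measurable_bind[OF m']) measurable
  have "emeasure (walk_measure \<nu> m) C
      = (\<integral>\<^sup>+x. emeasure (m x \<bind> (\<lambda>y. return (\<nu> \<Otimes>\<^sub>M \<nu>) (x, y))) C \<partial>\<nu>)"
    unfolding walk_measure_def by (rule emeasure_bind[OF ne k C])
  also have "\<dots> = (\<integral>\<^sup>+x. \<integral>\<^sup>+y. indicator C (x, y) \<partial>m x \<partial>\<nu>)"
  proof (rule nn_integral_cong)
    fix x assume x: "x \<in> space \<nu>"
    have s: "sets (m x) = sets \<nu>"
      using subprob_measurableD(2)[OF m' x] .
    have "(\<lambda>y. return (\<nu> \<Otimes>\<^sub>M \<nu>) (x, y)) \<in> \<nu> \<rightarrow>\<^sub>M subprob_algebra (\<nu> \<Otimes>\<^sub>M \<nu>)"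
      using x by measurable
    then have r: "(\<lambda>y. return (\<nu> \<Otimes>\<^sub>M \<nu>) (x, y)) \<in> m x \<rightarrow>\<^sub>M subprob_algebra (\<nu> \<Otimes>\<^sub>M \<nu>)"
      by (simp add: measurable_cong_sets[OF s refl])
    have "space (m x) \<noteq> {}"
      using sets_eq_imp_space_eq[OF s] ne by simp
    then show "emeasure (m x \<bind> (\<lambda>y. return (\<nu> \<Otimes>\<^sub>M \<nu>) (x, y))) C = (\<integral>\<^sup>+y. indicator C (x, y) \<partial>m x)"
      using C by (subst emeasure_bind[OF _ r C]) simp_all
  qed
  finally show ?thesis .
qed

end

theory Submission
  imports Defs
begin

text \<open>
  Testing the torsion equation with the torsional function \<open>f\<close> itself and integrating by parts
  (reversibility) gives \<open>\<integral>|\<nabla>f|\<^sup>p = 2 \<integral>\<^sub>\<Omega> f\<close>, so the Rayleigh quotient of \<open>f\<close> is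
  \<open>\<integral>\<^sub>\<Omega> f / \<integral>\<^sub>\<Omega> f\<^sup>p\<close>, and Jensen's inequality bounds \<open>\<integral>\<^sub>\<Omega> f\<^sup>p\<close> from below by
  \<open>(\<integral>\<^sub>\<Omega> f)\<^sup>p / \<nu>(\<Omega>)\<^sup>p\<^sup>-\<^sup>1\<close>.

  The torsional function is a chosen object, so its existence has to be established as well. It is
  the minimizer of \<open>J f = 1/(2p) \<integral>|\<nabla>f|\<^sup>p - \<integral>\<^sub>\<Omega> f\<close>. Uniform convexity of the \<open>p\<close>-th power makes a
  minimizing sequence Cauchy in energy, hence in \<open>L\<^sup>1\<close> by the Poincare inequality, and Fatou's lemma
  along an a.e. convergent subsequence replaces weak compactness. Passing from \<open>f\<close> to
  \<open>|f|\<close> does not increase \<open>J\<close>, and the first variation is the torsion equation.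
\<close>

section \<open>Convexity of the p-th power\<close>

text \<open>Up to the factor \<open>p\<close> this is the derivative of
  \<open>\<bar>t\<bar> powr p\<close>, the nonlinearity of the p-Laplacian. By the convention
  \<open>0 powr a = 0\<close> it vanishes at 0, also for p < 2.\<close>

definition psi :: "real \<Rightarrow> real \<Rightarrow> real" where
  "psi p t = \<bar>t\<bar> powr (p - 2) * t"

text \<open>For p < 2 the exponent \<open>p - 2\<close> is negative. Splitting into positive and
  negative parts leaves only the positive exponent \<open>p - 1\<close>, from which continuity and
  monotonicity can be read off.\<close>

lemma psi_eq_max:
  assumes "p > 1"
  shows "psi p t = max t 0 powr (p - 1) - max (- t) 0 powr (p - 1)"
proof -
  have *: "s powr (p - 2) * s = s powr (p - 1)" if "s > 0" for s :: real
    using that powr_add[of s "p - 2" 1] by simp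
  show ?thesis
    using *[of t] *[of "- t"] by (cases t "0::real" rule: linorder_cases) (auto simp: psi_def)
qed

lemma abs_psi:
  assumes "p > 1"
  shows "\<bar>psi p t\<bar> = \<bar>t\<bar> powr (p - 1)"
  by (cases t "0::real" rule: linorder_cases) (auto simp: psi_eq_max[OF assms])

lemma psi_mult_self: "psi p t * t = \<bar>t\<bar> powr p"
proof (cases "t = 0")
  case False
  then show ?thesis
    using powr_add[of "\<bar>t\<bar>" "p - 2" 2] by (simp add: psi_def power2_eq_square)
qed (simp add: psi_def)

lemma psi_minus: "psi p (- t) = - psi p t"
  by (simp add: psi_def)

lemma continuous_on_psi:
  assumes "p > 1"
  shows "continuous_on S (psi p)"
proof -
  have "continuous_on S (\<lambda>t. max t 0 powr (p - 1) - max (- t) 0 powr (p - 1))"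
    using assms by (intro continuous_intros continuous_on_powr') auto
  then show ?thesis
    by (simp add: psi_eq_max[OF assms, abs_def])
qed

lemma borel_measurable_psi [measurable]: "psi p \<in> borel_measurable borel"
  unfolding psi_def[abs_def] by measurable

lemma continuous_on_abs_powr:
  assumes "p > 0" "continuous_on S f"
  shows "continuous_on S (\<lambda>t. \<bar>f t :: real\<bar> powr p)"
  using assms by (intro continuous_intros continuous_on_powr') auto

lemma psi_strict_mono:
  assumes "p > 1" "s < t"
  shows "psi p s < psi p t"
proof -
  have le: "max u 0 powr (p - 1) \<le> max v 0 powr (p - 1)" if "u \<le> v" for u v :: real
    using that assms by (intro powr_mono2) auto
  \<comment> \<open>If t > 0, the positive part grows strictly; otherwise s < t \<le> 0 and the
    negative part shrinks strictly.\<close>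
  have "max s 0 powr (p - 1) < max t 0 powr (p - 1) \<or>
    max (- t) 0 powr (p - 1) < max (- s) 0 powr (p - 1)"
  proof (cases "t > 0")
    case True
    then show ?thesis
      using assms by (intro disjI1 powr_less_mono2) auto
  next
    case False
    then show ?thesis
      using assms by (intro disjI2 powr_less_mono2) auto
  qed
  moreover have "max s 0 powr (p - 1) \<le> max t 0 powr (p - 1)"
    "max (- t) 0 powr (p - 1) \<le> max (- s) 0 powr (p - 1)"
    using assms(2) by (auto intro!: le)
  ultimately show ?thesis
    unfolding psi_eq_max[OF assms(1)] by linarith
qed

lemma has_real_derivative_abs_powr:
  assumes p: "p > 1"
  shows "((\<lambda>t. \<bar>t\<bar> powr p) has_real_derivative p * psi p t) (at t)"
proof (cases t "0::real" rule: linorder_cases)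
  case greater
  have "((\<lambda>t. t powr p) has_real_derivative p * psi p t) (at t)"
    using has_real_derivative_powr[OF greater, of p] greater p by (simp add: psi_eq_max)
  moreover have "\<forall>\<^sub>F s in nhds t. s powr p = \<bar>s\<bar> powr p"
    using eventually_nhds_in_open[of "{0<..}" t] greater
    by (auto elim!: eventually_mono)
  ultimately show ?thesis
    by (subst (asm) DERIV_cong_ev[OF refl _ refl]) auto
next
  case less
  have "((\<lambda>t. (- t) powr p) has_real_derivative (p * (- t) powr (p - 1)) * - 1) (at t)"
    by (rule DERIV_chain2[OF has_real_derivative_powr]) (use less in \<open>auto intro!: derivative_eq_intros\<close>)
  then have "((\<lambda>t. (- t) powr p) has_real_derivative p * psi p t) (at t)"
    using less p by (simp add: psi_eq_max)
  moreover have "\<forall>\<^sub>F s in nhds t. (- s) powr p = \<bar>s\<bar> powr p"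
    using eventually_nhds_in_open[of "{..<0}" t] less
    by (auto elim!: eventually_mono)
  ultimately show ?thesis
    by (subst (asm) DERIV_cong_ev[OF refl _ refl]) auto
next
  case equal
  \<comment> \<open>At 0 the difference quotient is
    \<open>\<bar>h\<bar> powr p / h = psi p h\<close>, so the derivative is the limit of
    \<open>psi\<close> at 0.\<close>
  have "((\<lambda>h. psi p h) \<longlongrightarrow> psi p 0) (at 0)"
    using continuous_on_psi[OF p, of UNIV] by (auto simp: continuous_on_eq_continuous_at isCont_def)
  then have "((\<lambda>h. psi p h) \<longlongrightarrow> 0) (at 0)"
    by (simp add: psi_def)
  then have "((\<lambda>h. \<bar>h\<bar> powr p / h) \<longlongrightarrow> 0) (at 0)"
    by (rule Lim_transform_eventually) (auto simp: eventually_at_filter psi_mult_self[symmetric])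
  then show ?thesis
    using equal by (simp add: DERIV_def psi_def)
qed

text \<open>By the mean value theorem the increment is \<open>p * psi p z * (b - a)\<close> with z
  strictly between a and b, and \<open>psi\<close> is strictly increasing.\<close>

lemma abs_powr_above_tangent_strict:
  assumes p: "p > 1" and ne: "a \<noteq> b"
  shows "\<bar>a\<bar> powr p + p * psi p a * (b - a) < \<bar>b\<bar> powr p"
proof (cases "a < b")
  case True
  obtain z where z: "a < z" "z < b" "\<bar>b\<bar> powr p - \<bar>a\<bar> powr p = (b - a) * (p * psi p z)"
    using MVT2[OF True, of "\<lambda>t. \<bar>t\<bar> powr p" "\<lambda>t. p * psi p t"] has_real_derivative_abs_powr[OF p] by auto
  have "(b - a) * (p * psi p a) < (b - a) * (p * psi p z)"
    using psi_strict_mono[OF p z(1)] True p by (intro mult_strict_left_mono) auto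
  with z(3) show ?thesis
    by (simp add: mult_ac)
next
  case False
  with ne have lt: "b < a" by simp
  obtain z where z: "b < z" "z < a" "\<bar>a\<bar> powr p - \<bar>b\<bar> powr p = (a - b) * (p * psi p z)"
    using MVT2[OF lt, of "\<lambda>t. \<bar>t\<bar> powr p" "\<lambda>t. p * psi p t"] has_real_derivative_abs_powr[OF p] by auto
  have "(a - b) * (p * psi p z) < (a - b) * (p * psi p a)"
    using psi_strict_mono[OF p z(2)] lt p by (intro mult_strict_left_mono) auto
  with z(3) show ?thesis
    by (simp add: algebra_simps)
qed

lemma abs_powr_above_tangent:
  assumes "p > 1"
  shows "\<bar>a\<bar> powr p + p * psi p a * (b - a) \<le> \<bar>b\<bar> powr p"
  using abs_powr_above_tangent_strict[OF assms, of a b] by (cases "a = b") auto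

text \<open>The strict tangent inequality at the midpoint is evaluated at both endpoints; in the sum
  the linear terms cancel.\<close>

lemma abs_powr_midpoint_strict:
  fixes a b :: real
  assumes "p > 1" "a \<noteq> b"
  shows "\<bar>(a + b) / 2\<bar> powr p < (\<bar>a\<bar> powr p + \<bar>b\<bar> powr p) / 2"
proof -
  let ?c = "(a + b) / 2"
  have "?c \<noteq> a" "?c \<noteq> b"
    using assms(2) by (auto simp: field_simps)
  from abs_powr_above_tangent_strict[OF assms(1) this(1)]
    abs_powr_above_tangent_strict[OF assms(1) this(2)]
  have "2 * \<bar>?c\<bar> powr p + p * psi p ?c * ((a - ?c) + (b - ?c)) < \<bar>a\<bar> powr p + \<bar>b\<bar> powr p"
    unfolding distrib_left by linarith
  moreover have "(a - ?c) + (b - ?c) = 0"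
    by (simp add: field_simps)
  ultimately show ?thesis
    by simp
qed

lemma abs_powr_midpoint:
  fixes a b :: real
  assumes "p > 1"
  shows "\<bar>(a + b) / 2\<bar> powr p \<le> (\<bar>a\<bar> powr p + \<bar>b\<bar> powr p) / 2"
  using abs_powr_midpoint_strict[OF assms, of a b] by (cases "a = b") auto

section \<open>Growth bounds for p-th powers\<close>

lemma abs_add_powr_le:
  fixes a b :: real
  assumes "p > 0"
  shows "(\<bar>a\<bar> + \<bar>b\<bar>) powr p \<le> 2 powr p * (\<bar>a\<bar> powr p + \<bar>b\<bar> powr p)"
proof -
  have "(\<bar>a\<bar> + \<bar>b\<bar>) powr p \<le> (2 * max \<bar>a\<bar> \<bar>b\<bar>) powr p"
    using assms by (intro powr_mono2) auto
  also have "\<dots> = 2 powr p * max \<bar>a\<bar> \<bar>b\<bar> powr p"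
    by (simp add: powr_mult)
  also have "\<dots> \<le> 2 powr p * (\<bar>a\<bar> powr p + \<bar>b\<bar> powr p)"
    by (intro mult_left_mono) (auto simp: max_def)
  finally show ?thesis .
qed

lemma abs_diff_powr_le:
  fixes a b :: real
  assumes "p > 0"
  shows "\<bar>a - b\<bar> powr p \<le> 2 powr p * (\<bar>a\<bar> powr p + \<bar>b\<bar> powr p)"
  using powr_mono2[of p "\<bar>a - b\<bar>" "\<bar>a\<bar> + \<bar>b\<bar>"] abs_add_powr_le[OF assms, of a b] assms
  by linarith

text \<open>A crude form of Young's inequality, obtained by replacing both factors by the larger
  one. It serves integrability and domination only, so the constants are not optimized.\<close>

lemma young_powr:
  assumes "p > 1"
  shows "\<bar>psi p s * t\<bar> \<le> \<bar>s\<bar> powr p + \<bar>t\<bar> powr p"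
proof -
  let ?m = "max \<bar>s\<bar> \<bar>t\<bar>"
  have "\<bar>psi p s * t\<bar> \<le> ?m powr (p - 1) * ?m"
    unfolding abs_mult abs_psi[OF assms] using assms by (intro mult_mono powr_mono2) auto
  also have "\<dots> = ?m powr p"
    by (simp add: powr_mult_base mult.commute)
  also have "\<dots> \<le> \<bar>s\<bar> powr p + \<bar>t\<bar> powr p"
    by (auto simp: max_def)
  finally show ?thesis .
qed

text \<open>Above the threshold \<open>M\<close> the factor (|t|/M)^(p-1) is at least 1. The free
  threshold does the work of Hoelder's inequality: a small \<open>M\<close> makes the constant term
  small at the price of a large coefficient.\<close>

lemma abs_le_powr:
  fixes t :: real
  assumes p: "p > 1" and M: "M > 0"
  shows "\<bar>t\<bar> \<le> M + M powr (1 - p) * \<bar>t\<bar> powr p"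
proof (cases "\<bar>t\<bar> \<le> M")
  case True
  then show ?thesis
    by (simp add: add_increasing2)
next
  case False
  have "1 = M powr (1 - p) * M powr (p - 1)"
    using M by (simp flip: powr_add)
  also have "\<dots> \<le> M powr (1 - p) * \<bar>t\<bar> powr (p - 1)"
    using False M p by (intro mult_left_mono powr_mono2) auto
  finally have "\<bar>t\<bar> * 1 \<le> \<bar>t\<bar> * (M powr (1 - p) * \<bar>t\<bar> powr (p - 1))"
    by (intro mult_left_mono) auto
  also have "\<dots> = M powr (1 - p) * (\<bar>t\<bar> * \<bar>t\<bar> powr (p - 1))"
    by simp
  also have "\<dots> = M powr (1 - p) * \<bar>t\<bar> powr p"
    by (simp add: powr_mult_base)
  finally show ?thesis
    using M by simp
qed

text \<open>Compactness argument: on the compact set \<open>K\<close> of those b with |1 - b|^p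
  \<ge> e, the midpoint defect is continuous and positive, hence at least some d > 0, and C = 2^p /
  d suffices because |1 - b| \<le> 2. Off \<open>K\<close> the term with \<open>e\<close> is already
  large enough.\<close>

lemma powr_uniformly_convex_unit:
  assumes p: "p > 1" and e: "e > 0"
  shows "\<exists>C\<ge>0. \<forall>b::real. \<bar>b\<bar> \<le> 1 \<longrightarrow>
    \<bar>1 - b\<bar> powr p \<le> e * (1 + \<bar>b\<bar> powr p) + C * ((1 + \<bar>b\<bar> powr p) / 2 - \<bar>(1 + b) / 2\<bar> powr p)"
proof -
  define g where "g b = (1 + \<bar>b\<bar> powr p) / 2 - \<bar>(1 + b) / 2\<bar> powr p" for b :: real
  define K where "K = {b \<in> {-1..1::real}. e \<le> \<bar>1 - b\<bar> powr p}"
  have "K = {-1..1} \<inter> {b. e \<le> \<bar>1 - b\<bar> powr p}"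
    by (auto simp: K_def)
  moreover have "closed {b. e \<le> \<bar>1 - b\<bar> powr p}"
    using p by (intro closed_Collect_le continuous_on_abs_powr continuous_intros) auto
  ultimately have K: "compact K"
    by (auto intro!: compact_Int_closed)
  have cg: "continuous_on K g"
    unfolding g_def using p by (intro continuous_on_abs_powr continuous_intros) auto
  have g0: "g b \<ge> 0" for b
    using abs_powr_midpoint[OF p, of 1 b] by (simp add: g_def)
  have gpos: "g b > 0" if "b \<in> K" for b
    using abs_powr_midpoint_strict[OF p, of 1 b] that e by (cases "b = 1") (auto simp: g_def K_def)
  obtain d where d: "d > 0" "\<And>b. b \<in> K \<Longrightarrow> d \<le> g b"
  proof (cases "K = {}")
    case True
    then show ?thesis
      by (intro that[of 1]) auto
  next
    case False
    from continuous_attains_inf[OF K this cg] gpos that show ?thesis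
      by blast
  qed
  have "\<bar>1 - b\<bar> powr p \<le> e * (1 + \<bar>b\<bar> powr p) + (2 powr p / d) * g b" if b: "\<bar>b\<bar> \<le> 1" for b
  proof (cases "b \<in> K")
    case True
    have "\<bar>1 - b\<bar> powr p \<le> 2 powr p"
      using b p by (intro powr_mono2) auto
    also have "\<dots> \<le> (2 powr p / d) * g b"
      using d(1) d(2)[OF True] by (simp add: field_simps)
    finally show ?thesis
      using e by (simp add: add_increasing)
  next
    case False
    with b have "\<bar>1 - b\<bar> powr p \<le> e * 1"
      by (auto simp: K_def)
    also have "\<dots> \<le> e * (1 + \<bar>b\<bar> powr p)"
      using e by (intro mult_left_mono) auto
    finally show ?thesis
      using g0[of b] d by (simp add: add_increasing2)
  qed
  with d show ?thesis
    unfolding g_def by (intro exI[of _ "2 powr p / d"]) auto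
qed

text \<open>
  The midpoint defect of the \<open>p\<close>-th power controls the distance for every \<open>p > 1\<close> at once, so
  Clarkson's inequalities and their case distinction at \<open>p = 2\<close> are avoided.
\<close>

lemma powr_uniformly_convex:
  assumes p: "p > 1" and e: "e > 0"
  shows "\<exists>C\<ge>0. \<forall>a b::real. \<bar>a - b\<bar> powr p \<le> e * (\<bar>a\<bar> powr p + \<bar>b\<bar> powr p)
    + C * ((\<bar>a\<bar> powr p + \<bar>b\<bar> powr p) / 2 - \<bar>(a + b) / 2\<bar> powr p)"
proof -
  obtain C where C: "C \<ge> 0" "\<And>b::real. \<bar>b\<bar> \<le> 1 \<Longrightarrow>
    \<bar>1 - b\<bar> powr p \<le> e * (1 + \<bar>b\<bar> powr p) + C * ((1 + \<bar>b\<bar> powr p) / 2 - \<bar>(1 + b) / 2\<bar> powr p)"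
    using powr_uniformly_convex_unit[OF p e] by blast
  \<comment> \<open>Both sides are homogeneous of degree p and symmetric, so it is enough to treat
    |b| \<le> |a| and scale a to 1.\<close>
  have *: "\<bar>a - b\<bar> powr p \<le> e * (\<bar>a\<bar> powr p + \<bar>b\<bar> powr p)
    + C * ((\<bar>a\<bar> powr p + \<bar>b\<bar> powr p) / 2 - \<bar>(a + b) / 2\<bar> powr p)" if ab: "\<bar>b\<bar> \<le> \<bar>a\<bar>" for a b :: real
  proof (cases "a = 0")
    case False
    define s where "s = b / a"
    have b: "b = a * s" and s: "\<bar>s\<bar> \<le> 1"
      using False ab by (auto simp: s_def divide_le_eq_1)
    have eqs: "\<bar>a - b\<bar> powr p = \<bar>a\<bar> powr p * \<bar>1 - s\<bar> powr p"
      "\<bar>b\<bar> powr p = \<bar>a\<bar> powr p * \<bar>s\<bar> powr p"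
      "\<bar>(a + b) / 2\<bar> powr p = \<bar>a\<bar> powr p * \<bar>(1 + s) / 2\<bar> powr p"
      unfolding b by (simp_all flip: powr_mult abs_mult add: algebra_simps)
    have "\<bar>a\<bar> powr p * \<bar>1 - s\<bar> powr p \<le> \<bar>a\<bar> powr p *
      (e * (1 + \<bar>s\<bar> powr p) + C * ((1 + \<bar>s\<bar> powr p) / 2 - \<bar>(1 + s) / 2\<bar> powr p))"
      using C(2)[OF s] by (intro mult_left_mono) auto
    then show ?thesis
      unfolding eqs by (simp add: algebra_simps add_divide_distrib)
  qed (use ab in simp)
  have "\<bar>a - b\<bar> powr p \<le> e * (\<bar>a\<bar> powr p + \<bar>b\<bar> powr p)
    + C * ((\<bar>a\<bar> powr p + \<bar>b\<bar> powr p) / 2 - \<bar>(a + b) / 2\<bar> powr p)" for a b :: real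
    using *[of b a] *[of a b] by (cases "\<bar>b\<bar> \<le> \<bar>a\<bar>") (auto simp: add.commute abs_minus_commute)
  with C(1) show ?thesis
    by blast
qed

section \<open>Symmetric p-energies\<close>

text \<open>One eventual bound on the integrals yields both integrability of the limit and the same
  bound for it. This covers the p-th powers, the L^1 distances and the energies along a minimizing
  sequence.\<close>

lemma fatou_real:
  fixes u :: "nat \<Rightarrow> 'a \<Rightarrow> real"
  assumes [measurable]: "\<And>i. u i \<in> borel_measurable M" "v \<in> borel_measurable M"
    and int: "\<And>i. integrable M (u i)"
    and nonneg: "\<And>i x. 0 \<le> u i x"
    and lim: "AE x in M. (\<lambda>i. u i x) \<longlonglongrightarrow> v x"
    and bound: "\<forall>\<^sub>F i in sequentially. (\<integral>x. u i x \<partial>M) \<le> b"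
  shows "integrable M v" "(\<integral>x. v x \<partial>M) \<le> b"
proof -
  \<comment> \<open>\<open>ennreal\<close> sends negative reals to 0, so the final estimate can be
    read back in the reals only for nonnegative \<open>b\<close>.\<close>
  have b0: "0 \<le> b"
  proof -
    from bound obtain i where "(\<integral>x. u i x \<partial>M) \<le> b"
      by (auto simp: eventually_sequentially)
    moreover have "0 \<le> (\<integral>x. u i x \<partial>M)"
      by (simp add: nonneg)
    ultimately show ?thesis
      by linarith
  qed
  have v0: "AE x in M. 0 \<le> v x"
    using lim by eventually_elim (rule LIMSEQ_le_const, auto intro: nonneg)
  have "(\<integral>\<^sup>+x. ennreal (v x) \<partial>M) = (\<integral>\<^sup>+x. liminf (\<lambda>i. ennreal (u i x)) \<partial>M)"
    by (intro nn_integral_cong_AE)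
      (use lim in \<open>eventually_elim, simp add: lim_imp_Liminf[OF _ tendsto_ennrealI]\<close>)
  also have "\<dots> \<le> liminf (\<lambda>i. \<integral>\<^sup>+x. ennreal (u i x) \<partial>M)"
    by (rule nn_integral_liminf) measurable
  also have "\<dots> \<le> limsup (\<lambda>i. \<integral>\<^sup>+x. ennreal (u i x) \<partial>M)"
    by (rule Liminf_le_Limsup) simp
  also have "\<dots> \<le> ennreal b"
    using bound
    by (intro Limsup_bounded)
      (auto elim!: eventually_mono simp: nn_integral_eq_integral[OF int] nonneg intro!: ennreal_leI)
  finally have le: "(\<integral>\<^sup>+x. ennreal (v x) \<partial>M) \<le> ennreal b" .
  show iv: "integrable M v"
    using le v0 by (intro integrableI_nonneg) (auto simp: top.extremum_strict le_less_trans)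
  show "(\<integral>x. v x \<partial>M) \<le> b"
    using le b0 by (simp add: nn_integral_eq_integral[OF iv v0])
qed

text \<open>
  \<open>\<mu>\<close> stands for \<open>dm\<^sub>x(y) d\<nu>(x)\<close> restricted to pairs of points of \<open>\<Omega>\<^sub>m\<close>. Elements of \<open>L\<^sup>p\<^sub>0\<close> are
  represented by functions vanishing everywhere outside \<open>\<Omega>\<close>, not only almost everywhere on the
  boundary.
\<close>

locale torsion_problem =
  fixes \<nu> :: "'a measure" and \<mu> :: "('a \<times> 'a) measure" and \<Omega> :: "'a set" and p c :: real
  assumes p_gt_1: "p > 1"
    and Omega [measurable]: "\<Omega> \<in> sets \<nu>"
    and Omega_finite: "emeasure \<nu> \<Omega> < \<infinity>"
    and sets_mu [measurable_cong]: "sets \<mu> = sets (\<nu> \<Otimes>\<^sub>M \<nu>)"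
    and symmetric: "distr \<mu> \<mu> (\<lambda>z. (snd z, fst z)) = \<mu>"
    and marginal: "\<And>g. g \<in> borel_measurable \<nu> \<Longrightarrow> (\<integral>\<^sup>+z. g (fst z) \<partial>\<mu>) \<le> (\<integral>\<^sup>+x. g x \<partial>\<nu>)"
    and c_pos: "c > 0"
    and poincare: "\<And>f. f \<in> borel_measurable \<nu> \<Longrightarrow> integrable \<nu> (\<lambda>x. \<bar>f x\<bar> powr p) \<Longrightarrow>
      (\<And>x. x \<notin> \<Omega> \<Longrightarrow> f x = 0) \<Longrightarrow>
      ennreal c * (\<integral>\<^sup>+x. ennreal (\<bar>f x\<bar> powr p) \<partial>\<nu>)
        \<le> (\<integral>\<^sup>+z. ennreal (\<bar>f (snd z) - f (fst z)\<bar> powr p) \<partial>\<mu>)"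
begin

section \<open>Coordinate exchange and marginals of \<open>\<mu>\<close>\<close>

lemma swap_measurable [measurable]: "(\<lambda>z. (snd z, fst z)) \<in> \<mu> \<rightarrow>\<^sub>M \<mu>"
  unfolding measurable_cong_sets[OF sets_mu sets_mu] by measurable

lemma integrable_swap:
  fixes F :: "'a \<times> 'a \<Rightarrow> real"
  assumes "integrable \<mu> F"
  shows "integrable \<mu> (\<lambda>z. F (snd z, fst z))"
  using assms by (subst (asm) symmetric[symmetric]) (rule integrable_distr[OF swap_measurable])

lemma integral_swap:
  fixes F :: "'a \<times> 'a \<Rightarrow> real"
  assumes [measurable]: "F \<in> borel_measurable \<mu>"
  shows "(\<integral>z. F (snd z, fst z) \<partial>\<mu>) = (\<integral>z. F z \<partial>\<mu>)"
  by (subst (2) symmetric[symmetric]) (subst integral_distr[OF swap_measurable], auto)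

lemma integrable_fst:
  fixes g :: "'a \<Rightarrow> real"
  assumes "integrable \<nu> g"
  shows "integrable \<mu> (\<lambda>z. g (fst z))"
proof (rule integrableI_bounded)
  have [measurable]: "g \<in> borel_measurable \<nu>"
    using assms by auto
  show "(\<lambda>z. g (fst z)) \<in> borel_measurable \<mu>"
    by measurable
  have "(\<integral>\<^sup>+z. ennreal (norm (g (fst z))) \<partial>\<mu>) \<le> (\<integral>\<^sup>+x. ennreal (norm (g x)) \<partial>\<nu>)"
    by (rule marginal) measurable
  also have "\<dots> < \<infinity>"
    using assms by (simp add: integrable_iff_bounded)
  finally show "(\<integral>\<^sup>+z. ennreal (norm (g (fst z))) \<partial>\<mu>) < \<infinity>" .
qed

lemma integrable_snd:
  fixes g :: "'a \<Rightarrow> real"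
  assumes "integrable \<nu> g"
  shows "integrable \<mu> (\<lambda>z. g (snd z))"
  using integrable_swap[OF integrable_fst[OF assms]] by simp

text \<open>By the marginal bound, a \<open>\<nu>\<close>-null set lifts to a
  \<open>\<mu>\<close>-null cylinder. Pointwise convergence of functions thereby passes to their
  gradients.\<close>

lemma AE_fst:
  assumes "AE x in \<nu>. P x"
  shows "AE z in \<mu>. P (fst z)"
proof -
  from assms obtain N where N: "N \<in> null_sets \<nu>" "{x \<in> space \<nu>. \<not> P x} \<subseteq> N"
    by (auto elim!: AE_E)
  have sp: "space \<mu> = space \<nu> \<times> space \<nu>"
    using sets_eq_imp_space_eq[OF sets_mu] by (simp add: space_pair_measure)
  have N_meas [measurable]: "N \<in> sets \<nu>"
    using N by auto
  have "(\<integral>\<^sup>+z. indicator N (fst z) \<partial>\<mu>) \<le> (\<integral>\<^sup>+x. indicator N x \<partial>\<nu>)"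
    by (rule marginal) measurable
  also have "\<dots> = 0"
    using N(1) by (simp add: null_setsD1)
  finally have "AE z in \<mu>. indicator N (fst z) = (0::ennreal)"
    by (subst (asm) le_zero_eq, subst (asm) nn_integral_0_iff_AE) auto
  then show ?thesis
    by (rule AE_mp) (use N sp in \<open>auto simp: indicator_def split: if_splits intro!: AE_I2\<close>)
qed

lemma AE_snd:
  assumes "AE x in \<nu>. P x"
  shows "AE z in \<mu>. P (snd z)"
proof -
  have "AE z in distr \<mu> \<mu> (\<lambda>z. (snd z, fst z)). P (fst z)"
    unfolding symmetric by (rule AE_fst[OF assms])
  from AE_distrD[OF swap_measurable this] show ?thesis
    by simp
qed

section \<open>Admissible functions, their energy and integration by parts\<close>

definition admissible :: "('a \<Rightarrow> real) \<Rightarrow> bool" where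
  "admissible f \<longleftrightarrow> f \<in> borel_measurable \<nu> \<and> integrable \<nu> (\<lambda>x. \<bar>f x\<bar> powr p) \<and> (\<forall>x. x \<notin> \<Omega> \<longrightarrow> f x = 0)"

abbreviation grad :: "('a \<Rightarrow> real) \<Rightarrow> 'a \<times> 'a \<Rightarrow> real" where
  "grad f z \<equiv> f (snd z) - f (fst z)"

definition energy :: "('a \<Rightarrow> real) \<Rightarrow> real" where
  "energy f = (\<integral>z. \<bar>grad f z\<bar> powr p \<partial>\<mu>)"

text \<open>The factor 1/(2p) normalizes the Euler-Lagrange equation: differentiating the energy
  produces p, and integrating by parts produces 2.\<close>

definition J :: "('a \<Rightarrow> real) \<Rightarrow> real" where
  "J f = energy f / (2 * p) - (\<integral>x. f x \<partial>\<nu>)"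

lemma admissible_measurable: "admissible f \<Longrightarrow> f \<in> borel_measurable \<nu>"
  by (simp add: admissible_def)

lemma admissible_integrable_powr: "admissible f \<Longrightarrow> integrable \<nu> (\<lambda>x. \<bar>f x\<bar> powr p)"
  by (simp add: admissible_def)

lemma admissible_outside: "admissible f \<Longrightarrow> x \<notin> \<Omega> \<Longrightarrow> f x = 0"
  by (simp add: admissible_def)

lemma integrable_indicator_Omega: "integrable \<nu> (indicator \<Omega> :: 'a \<Rightarrow> real)"
  using Omega_finite by (intro integrable_real_indicator) auto

lemma admissible_abs_le:
  assumes "admissible f" "M > 0"
  shows "\<bar>f x\<bar> \<le> M * indicator \<Omega> x + M powr (1 - p) * \<bar>f x\<bar> powr p"
  using abs_le_powr[OF p_gt_1 assms(2), of "f x"] admissible_outside[OF assms(1), of x]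
  by (auto simp: indicator_def)

lemma admissible_integrable:
  assumes "admissible f"
  shows "integrable \<nu> f"
proof (rule Bochner_Integration.integrable_bound)
  show "integrable \<nu> (\<lambda>x. 1 * indicator \<Omega> x + 1 powr (1 - p) * \<bar>f x\<bar> powr p)"
    using admissible_integrable_powr[OF assms] integrable_indicator_Omega by auto
  show "AE x in \<nu>. norm (f x) \<le> norm (1 * indicator \<Omega> x + 1 powr (1 - p) * \<bar>f x\<bar> powr p)"
    using admissible_abs_le[OF assms, of 1] by (intro AE_I2) auto
qed (rule admissible_measurable[OF assms])

lemma admissible_lincomb:
  assumes f: "admissible f" and g: "admissible g"
  shows "admissible (\<lambda>x. s * f x + t * g x)"
  unfolding admissible_def
proof (intro conjI allI impI)
  note [measurable] = admissible_measurable[OF f] admissible_measurable[OF g]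
  show "(\<lambda>x. s * f x + t * g x) \<in> borel_measurable \<nu>"
    by measurable
  show "integrable \<nu> (\<lambda>x. \<bar>s * f x + t * g x\<bar> powr p)"
  proof (rule Bochner_Integration.integrable_bound)
    show "integrable \<nu> (\<lambda>x. 2 powr p * (\<bar>s\<bar> powr p * \<bar>f x\<bar> powr p + \<bar>t\<bar> powr p * \<bar>g x\<bar> powr p))"
      using admissible_integrable_powr[OF f] admissible_integrable_powr[OF g] by auto
    show "AE x in \<nu>. norm (\<bar>s * f x + t * g x\<bar> powr p) \<le>
        norm (2 powr p * (\<bar>s\<bar> powr p * \<bar>f x\<bar> powr p + \<bar>t\<bar> powr p * \<bar>g x\<bar> powr p))"
      using abs_diff_powr_le[of p "s * f x" "- t * g x" for x] p_gt_1
      by (intro AE_I2) (simp add: abs_mult powr_mult)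
  qed measurable
qed (use f g in \<open>simp add: admissible_outside\<close>)

lemma admissible_indicator:
  assumes "A \<in> sets \<nu>" "A \<subseteq> \<Omega>"
  shows "admissible (indicator A)"
proof -
  have "(\<lambda>x. \<bar>indicator A x :: real\<bar> powr p) = indicator A"
    using p_gt_1 by (auto simp: indicator_def)
  moreover have "emeasure \<nu> A < \<infinity>"
    using emeasure_mono[OF assms(2) Omega] Omega_finite by (rule le_less_trans)
  ultimately show ?thesis
    using assms by (auto simp: admissible_def indicator_def)
qed

lemma admissible_abs: "admissible f \<Longrightarrow> admissible (\<lambda>x. \<bar>f x\<bar>)"
  by (auto simp: admissible_def)

lemma grad_measurable:
  assumes "admissible f"
  shows "grad f \<in> borel_measurable \<mu>"
proof -
  note [measurable] = admissible_measurable[OF assms]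
  show ?thesis by measurable
qed

lemma integrable_grad_powr:
  assumes "admissible f"
  shows "integrable \<mu> (\<lambda>z. \<bar>grad f z\<bar> powr p)"
proof (rule Bochner_Integration.integrable_bound)
  note [measurable] = grad_measurable[OF assms]
  show "integrable \<mu> (\<lambda>z. 2 powr p * (\<bar>f (snd z)\<bar> powr p + \<bar>f (fst z)\<bar> powr p))"
    using integrable_fst[OF admissible_integrable_powr[OF assms]]
      integrable_snd[OF admissible_integrable_powr[OF assms]] by auto
  show "AE z in \<mu>. norm (\<bar>grad f z\<bar> powr p) \<le> norm (2 powr p * (\<bar>f (snd z)\<bar> powr p + \<bar>f (fst z)\<bar> powr p))"
    using abs_diff_powr_le p_gt_1 by (intro AE_I2) simp
  show "(\<lambda>z. \<bar>grad f z\<bar> powr p) \<in> borel_measurable \<mu>"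
    by measurable
qed

lemma energy_nonneg: "0 \<le> energy f"
  by (simp add: energy_def)

lemma nn_integral_grad_powr:
  assumes "admissible f"
  shows "(\<integral>\<^sup>+z. ennreal (\<bar>grad f z\<bar> powr p) \<partial>\<mu>) = ennreal (energy f)"
  unfolding energy_def by (rule nn_integral_eq_integral[OF integrable_grad_powr[OF assms]]) simp

lemma energy_ge:
  assumes "admissible f"
  shows "c * (\<integral>x. \<bar>f x\<bar> powr p \<partial>\<nu>) \<le> energy f"
proof -
  have "ennreal (c * (\<integral>x. \<bar>f x\<bar> powr p \<partial>\<nu>)) \<le> ennreal (energy f)"
    using poincare[of f] assms c_pos
    by (simp add: admissible_def nn_integral_grad_powr[OF assms] nn_integral_eq_integral ennreal_mult)
  then show ?thesis
    using energy_nonneg by (simp add: ennreal_le_iff)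
qed

text \<open>The L^1 norm is controlled by the energy with \<open>M\<close> left free: fixing a small
  \<open>M\<close> first and then making the energy small makes the whole bound small.\<close>

lemma integral_abs_le:
  assumes f: "admissible f" and M: "M > 0"
  shows "(\<integral>x. \<bar>f x\<bar> \<partial>\<nu>) \<le> M * measure \<nu> \<Omega> + M powr (1 - p) / c * energy f"
proof -
  have "(\<integral>x. \<bar>f x\<bar> \<partial>\<nu>) \<le> (\<integral>x. M * indicator \<Omega> x + M powr (1 - p) * \<bar>f x\<bar> powr p \<partial>\<nu>)"
    using admissible_abs_le[OF f M] admissible_integrable_powr[OF f] admissible_integrable[OF f]
      integrable_indicator_Omega by (intro integral_mono) auto
  also have "\<dots> = M * measure \<nu> \<Omega> + M powr (1 - p) * (\<integral>x. \<bar>f x\<bar> powr p \<partial>\<nu>)"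
    using admissible_integrable_powr[OF f] integrable_indicator_Omega Omega_finite
    by (subst Bochner_Integration.integral_add) auto
  also have "(\<integral>x. \<bar>f x\<bar> powr p \<partial>\<nu>) \<le> energy f / c"
    using energy_ge[OF f] c_pos by (simp add: field_simps)
  finally show ?thesis
    by (simp add: mult_left_mono)
qed

lemma integrable_psi_grad_mult:
  assumes f: "admissible f" and g: "g \<in> borel_measurable \<mu>" "integrable \<mu> (\<lambda>z. \<bar>g z\<bar> powr p)"
  shows "integrable \<mu> (\<lambda>z. psi p (grad f z) * g z)"
proof (rule Bochner_Integration.integrable_bound)
  note [measurable] = grad_measurable[OF f] g(1)
  show "integrable \<mu> (\<lambda>z. \<bar>grad f z\<bar> powr p + \<bar>g z\<bar> powr p)"
    using integrable_grad_powr[OF f] g(2) by auto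
  show "AE z in \<mu>. norm (psi p (grad f z) * g z) \<le> norm (\<bar>grad f z\<bar> powr p + \<bar>g z\<bar> powr p)"
    using young_powr[OF p_gt_1] by (intro AE_I2) simp
  show "(\<lambda>z. psi p (grad f z) * g z) \<in> borel_measurable \<mu>"
    by measurable
qed

lemma integrable_psi_grad_fst:
  assumes f: "admissible f" and g: "admissible g"
  shows "integrable \<mu> (\<lambda>z. psi p (grad f z) * g (fst z))"
proof (rule integrable_psi_grad_mult[OF f])
  note [measurable] = admissible_measurable[OF g]
  show "(\<lambda>z. g (fst z)) \<in> borel_measurable \<mu>"
    by measurable
qed (rule integrable_fst[OF admissible_integrable_powr[OF g]])

text \<open>Exchanging the coordinates flips the sign of \<open>psi p (grad f z)\<close> and turns
  \<open>g (snd z)\<close> into \<open>g (fst z)\<close>. By symmetry of \<open>\<mu>\<close> both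
  halves of \<open>grad g\<close> contribute equally.\<close>

lemma integral_by_parts:
  assumes f: "admissible f" and g: "admissible g"
  shows "(\<integral>z. psi p (grad f z) * grad g z \<partial>\<mu>) = - 2 * (\<integral>z. psi p (grad f z) * g (fst z) \<partial>\<mu>)"
proof -
  let ?F = "\<lambda>z. psi p (grad f z) * g (fst z)"
  have int: "integrable \<mu> ?F"
    by (rule integrable_psi_grad_fst[OF f g])
  have swap: "?F (snd z, fst z) = - (psi p (grad f z) * g (snd z))" for z
    using psi_minus[of p "grad f z"] by simp
  have "(\<integral>z. psi p (grad f z) * grad g z \<partial>\<mu>) = (\<integral>z. - ?F (snd z, fst z) - ?F z \<partial>\<mu>)"
    unfolding swap by (simp add: algebra_simps)
  also have "\<dots> = (\<integral>z. - ?F (snd z, fst z) \<partial>\<mu>) - (\<integral>z. ?F z \<partial>\<mu>)"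
    by (rule Bochner_Integration.integral_diff)
      (use int integrable_swap[OF int] in auto)
  also have "(\<integral>z. - ?F (snd z, fst z) \<partial>\<mu>) = - (\<integral>z. ?F z \<partial>\<mu>)"
    using integral_swap[of ?F] int by (subst integral_minus) auto
  finally show ?thesis
    by simp
qed

section \<open>Coercivity and uniform convexity of the functional\<close>

lemma J_bounded_below: "\<exists>C. \<forall>f. admissible f \<longrightarrow> energy f / (4 * p) - C \<le> J f"
proof -
  \<comment> \<open>This \<open>M\<close> solves M^(1-p) / c = 1/(4p), so that the linear term of
    \<open>J\<close> absorbs exactly half of the energy term.\<close>
  define M where "M = (c / (4 * p)) powr (1 / (1 - p))"
  have M: "M > 0" "M powr (1 - p) / c = 1 / (4 * p)"
    using c_pos p_gt_1 by (auto simp: M_def powr_powr)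
  have "energy f / (4 * p) - M * measure \<nu> \<Omega> \<le> J f" if f: "admissible f" for f
  proof -
    have "(\<integral>x. f x \<partial>\<nu>) \<le> (\<integral>x. \<bar>f x\<bar> \<partial>\<nu>)"
      using admissible_integrable[OF f] by (intro integral_mono) auto
    also have "\<dots> \<le> M * measure \<nu> \<Omega> + energy f / (4 * p)"
      using integral_abs_le[OF f M(1)] unfolding M(2) by simp
    finally show ?thesis
      by (simp add: J_def)
  qed
  then show ?thesis
    by blast
qed

text \<open>The pointwise uniform convexity is integrated over the gradients. The linear part of
  \<open>J\<close> cancels in the midpoint defect, so the defect of the energy is
  \<open>2 * p\<close> times that of \<open>J\<close>.\<close>

lemma energy_diff_le:
  assumes e: "e > 0"
  shows "\<exists>C\<ge>0. \<forall>f g. admissible f \<longrightarrow> admissible g \<longrightarrow>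
    energy (\<lambda>x. f x - g x) \<le> e * (energy f + energy g) +
      C * ((J f + J g) / 2 - J (\<lambda>x. (f x + g x) / 2))"
proof -
  obtain C where C: "C \<ge> 0" "\<And>a b::real. \<bar>a - b\<bar> powr p \<le> e * (\<bar>a\<bar> powr p + \<bar>b\<bar> powr p)
    + C * ((\<bar>a\<bar> powr p + \<bar>b\<bar> powr p) / 2 - \<bar>(a + b) / 2\<bar> powr p)"
    using powr_uniformly_convex[OF p_gt_1 e] by blast
  have "energy (\<lambda>x. f x - g x) \<le> e * (energy f + energy g) +
      (2 * p * C) * ((J f + J g) / 2 - J (\<lambda>x. (f x + g x) / 2))"
    if f: "admissible f" and g: "admissible g" for f g
  proof -
    have d: "admissible (\<lambda>x. f x - g x)"
      using admissible_lincomb[OF f g, of 1 "- 1"] by simp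
    have m: "admissible (\<lambda>x. (f x + g x) / 2)"
      using admissible_lincomb[OF f g, of "1 / 2" "1 / 2"] by (simp add: add_divide_distrib)
    note int = integrable_grad_powr[OF f] integrable_grad_powr[OF g]
      integrable_grad_powr[OF d] integrable_grad_powr[OF m]
    have "energy (\<lambda>x. f x - g x) \<le> (\<integral>z. e * (\<bar>grad f z\<bar> powr p + \<bar>grad g z\<bar> powr p)
      + C * ((\<bar>grad f z\<bar> powr p + \<bar>grad g z\<bar> powr p) / 2 - \<bar>grad (\<lambda>x. (f x + g x) / 2) z\<bar> powr p) \<partial>\<mu>)"
      unfolding energy_def
    proof (rule integral_mono)
      fix z
      have "f (snd z) - g (snd z) - (f (fst z) - g (fst z)) = grad f z - grad g z"
        "(f (snd z) + g (snd z)) / 2 - (f (fst z) + g (fst z)) / 2 = (grad f z + grad g z) / 2"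
        by (simp_all add: diff_divide_distrib add_divide_distrib)
      then show "\<bar>f (snd z) - g (snd z) - (f (fst z) - g (fst z))\<bar> powr p \<le>
        e * (\<bar>grad f z\<bar> powr p + \<bar>grad g z\<bar> powr p) + C * ((\<bar>grad f z\<bar> powr p + \<bar>grad g z\<bar> powr p) / 2
          - \<bar>(f (snd z) + g (snd z)) / 2 - (f (fst z) + g (fst z)) / 2\<bar> powr p)"
        using C(2)[of "grad f z" "grad g z"] by (simp only:)
    qed (use int in auto)
    also have "\<dots> = e * (energy f + energy g) +
        C * ((energy f + energy g) / 2 - energy (\<lambda>x. (f x + g x) / 2))"
      unfolding energy_def using int
      by (simp add: Bochner_Integration.integral_add Bochner_Integration.integral_diff
          del: Bochner_Integration.integral_divide_zero flip: Bochner_Integration.integral_divide_zero)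
    also have "(energy f + energy g) / 2 - energy (\<lambda>x. (f x + g x) / 2) =
        2 * p * ((J f + J g) / 2 - J (\<lambda>x. (f x + g x) / 2))"
      using admissible_integrable[OF f] admissible_integrable[OF g] p_gt_1
      by (simp add: J_def field_simps)
    finally show ?thesis
      by (simp add: mult_ac)
  qed
  moreover have "0 \<le> 2 * p * C"
    using C p_gt_1 by simp
  ultimately show ?thesis
    by blast
qed

end

section \<open>The weak torsion problem\<close>

context torsion_problem begin

section \<open>Existence of a minimizer by the direct method\<close>

lemma minimizing_sequence:
  obtains u :: "nat \<Rightarrow> 'a \<Rightarrow> real" and I B
  where "\<And>n. admissible (u n)" "\<And>n. J (u n) \<le> I + 1 / (real n + 1)"
    "\<And>f. admissible f \<Longrightarrow> I \<le> J f" "\<And>n. energy (u n) \<le> B"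
proof -
  obtain C where C: "\<And>f. admissible f \<Longrightarrow> energy f / (4 * p) - C \<le> J f"
    using J_bounded_below by blast
  define I where "I = Inf (J ` Collect admissible)"
  have ne: "J ` Collect admissible \<noteq> {}"
    \<comment> \<open>The zero function, written as the indicator of the empty set, is
      admissible.\<close>
    using admissible_indicator[of "{}"] by auto
  have bdd: "bdd_below (J ` Collect admissible)"
  proof (rule bdd_belowI2)
    fix f assume "f \<in> Collect admissible"
    then have "energy f / (4 * p) - C \<le> J f"
      using C by simp
    moreover have "0 \<le> energy f / (4 * p)"
      using energy_nonneg p_gt_1 by simp
    ultimately show "- C \<le> J f"
      by linarith
  qed
  have I: "I \<le> J f" if "admissible f" for f
    unfolding I_def using that bdd by (intro cINF_lower) auto
  have "\<exists>f. admissible f \<and> J f < I + 1 / (real n + 1)" for n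
    using cInf_lessD[OF ne, of "I + 1 / (real n + 1)"] by (auto simp: I_def)
  then obtain u where u: "\<And>n. admissible (u n)" "\<And>n. J (u n) < I + 1 / (real n + 1)"
    by metis
  have "energy (u n) \<le> 4 * p * (I + 1 + C)" for n
  proof -
    have "energy (u n) / (4 * p) \<le> J (u n) + C"
      using C[OF u(1)[of n]] by simp
    also have "\<dots> \<le> I + 1 + C"
    proof -
      have "1 / (real n + 1) \<le> 1"
        by simp
      with u(2)[of n] show ?thesis
        by linarith
    qed
    finally show ?thesis
      using p_gt_1 by (simp add: field_simps)
  qed
  with u I show ?thesis
    by (intro that[of u I]) (auto intro: less_imp_le)
qed

text \<open>The midpoint of two late members still has \<open>J\<close> at least \<open>I\<close>,
  so their midpoint defect is at most 1/(N+1). \<open>energy_diff_le\<close> converts this into a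
  small energy of the difference, and \<open>integral_abs_le\<close> into a small L^1
  distance.\<close>

lemma minimizing_sequence_Cauchy:
  assumes u: "\<And>n. admissible (u n)" "\<And>n. J (u n) \<le> I + 1 / (real n + 1)"
    and I: "\<And>f. admissible f \<Longrightarrow> I \<le> J f"
    and B: "\<And>n. energy (u n) \<le> B"
    and e: "e > 0"
  shows "\<exists>N. \<forall>i\<ge>N. \<forall>j\<ge>N. (\<integral>x. \<bar>u i x - u j x\<bar> \<partial>\<nu>) < e"
proof -
  have B0: "0 \<le> B"
    using energy_nonneg[of "u 0"] B[of 0] by linarith
  \<comment> \<open>The constants are fixed in the order \<open>M\<close>, \<eta>, \<open>C\<close>,
    \<open>N\<close>: \<open>M\<close> keeps the measure term below e/2, \<eta> the bounded energies
    below e/4, and \<open>N\<close> the defect below e/4. The added 1 in the denominators excludes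
    division by zero.\<close>
  define M where "M = e / (2 * (measure \<nu> \<Omega> + 1))"
  have M: "M > 0" "M * measure \<nu> \<Omega> < e / 2"
    using e by (auto simp: M_def field_simps add_pos_nonneg)
  define D where "D = M powr (1 - p) / c"
  have D: "D > 0"
    using M c_pos by (simp add: D_def)
  define \<eta> where "\<eta> = e / (8 * D * (B + 1))"
  have \<eta>: "\<eta> > 0" "D * (\<eta> * (2 * B)) \<le> e / 4"
    using e D B0 by (auto simp: \<eta>_def field_simps add_pos_nonneg)
  obtain C where C: "C \<ge> 0" "\<And>f g. admissible f \<Longrightarrow> admissible g \<Longrightarrow>
    energy (\<lambda>x. f x - g x) \<le> \<eta> * (energy f + energy g) +
      C * ((J f + J g) / 2 - J (\<lambda>x. (f x + g x) / 2))"
    using energy_diff_le[OF \<eta>(1)] by blast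
  obtain N :: nat where N: "4 * D * C / e < real N"
    using reals_Archimedean2 by blast
  have "(\<integral>x. \<bar>u i x - u j x\<bar> \<partial>\<nu>) < e" if ij: "i \<ge> N" "j \<ge> N" for i j
  proof -
    have d: "admissible (\<lambda>x. u i x - u j x)"
      using admissible_lincomb[OF u(1) u(1), of 1 i "- 1" j] by simp
    have m: "admissible (\<lambda>x. (u i x + u j x) / 2)"
      using admissible_lincomb[OF u(1) u(1), of "1 / 2" i "1 / 2" j] by (simp add: add_divide_distrib)
    have J_le: "J (u n) \<le> I + 1 / (real N + 1)" if "n \<ge> N" for n
    proof -
      have "1 / (real n + 1) \<le> 1 / (real N + 1)"
        using that by (intro divide_left_mono) auto
      with u(2)[of n] show ?thesis by linarith
    qed
    have "(J (u i) + J (u j)) / 2 - J (\<lambda>x. (u i x + u j x) / 2) \<le> 1 / (real N + 1)"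
      using J_le[OF ij(1)] J_le[OF ij(2)] I[OF m] by argo
    then have "energy (\<lambda>x. u i x - u j x) \<le> \<eta> * (2 * B) + C * (1 / (real N + 1))"
      using B[of i] B[of j] \<eta>(1) C(1)
      by (intro order_trans[OF C(2)[OF u(1) u(1)]] add_mono mult_left_mono) auto
    then have "D * energy (\<lambda>x. u i x - u j x) \<le> D * (\<eta> * (2 * B) + C * (1 / (real N + 1)))"
      using D by (intro mult_left_mono) auto
    also have "\<dots> = D * (\<eta> * (2 * B)) + D * C / (real N + 1)"
      by (simp add: algebra_simps)
    also have "\<dots> < e / 4 + e / 4"
    proof (rule add_le_less_mono)
      have "4 * D * C < e * (real N + 1)"
        using N e by (simp add: field_simps)
      then show "D * C / (real N + 1) < e / 4"
        by (simp add: field_simps)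
    qed (rule \<eta>(2))
    finally have "D * energy (\<lambda>x. u i x - u j x) < e / 2"
      by simp
    then show ?thesis
      using integral_abs_le[OF d M(1)] M(2) unfolding D_def by linarith
  qed
  then show ?thesis
    by blast
qed

lemma ex_minimizer: "\<exists>f. admissible f \<and> (\<forall>g. admissible g \<longrightarrow> J f \<le> J g)"
proof -
  obtain u I B where u: "\<And>n. admissible (u n)" "\<And>n. J (u n) \<le> I + 1 / (real n + 1)"
    and I: "\<And>f. admissible f \<Longrightarrow> I \<le> J f" and B: "\<And>n. energy (u n) \<le> B"
    by (rule minimizing_sequence) blast
  note Cauchy_L1 = minimizing_sequence_Cauchy[OF u I B]
  obtain r where r: "strict_mono r" "AE x in \<nu>. Cauchy (\<lambda>i. u (r i) x)"
    by (rule cauchy_L1_AE_cauchy_subseq[of \<nu> u])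
      (use admissible_integrable[OF u(1)] Cauchy_L1 in auto)
  define g where "g i = u (r i)" for i
  \<comment> \<open>The cutoff makes the limit vanish everywhere outside \<open>\<Omega>\<close>, as
    admissibility demands, and not just almost everywhere.\<close>
  define f where "f x = (if x \<in> \<Omega> then lim (\<lambda>i. g i x) else 0)" for x
  have g: "admissible (g i)" "energy (g i) \<le> B" "I \<le> J (g i)" for i
    using u(1) B I by (auto simp: g_def)
  note [measurable] = admissible_measurable[OF g(1)] grad_measurable[OF g(1)]
  have f_meas [measurable]: "f \<in> borel_measurable \<nu>"
    unfolding f_def by measurable
  have lim: "AE x in \<nu>. (\<lambda>i. g i x) \<longlonglongrightarrow> f x"
    using r(2) by eventually_elim
      (auto simp: f_def g_def admissible_outside[OF u(1)] Cauchy_convergent convergent_LIMSEQ_iff[symmetric])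
  have int_powr: "(\<integral>x. \<bar>g i x\<bar> powr p \<partial>\<nu>) \<le> B / c" for i
    using energy_ge[OF g(1)[of i]] g(2)[of i] c_pos by (simp add: field_simps)
  have f: "admissible f"
    unfolding admissible_def
  proof (intro conjI allI impI)
    show "integrable \<nu> (\<lambda>x. \<bar>f x\<bar> powr p)"
    proof (rule fatou_real(1))
      show "AE x in \<nu>. (\<lambda>i. \<bar>g i x\<bar> powr p) \<longlonglongrightarrow> \<bar>f x\<bar> powr p"
        using lim by eventually_elim (use p_gt_1 in \<open>intro tendsto_powr' tendsto_intros, auto\<close>)
      show "\<forall>\<^sub>F i in sequentially. (\<integral>x. \<bar>g i x\<bar> powr p \<partial>\<nu>) \<le> B / c"
        using int_powr by simp
    qed (use admissible_integrable_powr[OF g(1)] in auto)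
  qed (auto simp: f_def)
  have L1: "(\<lambda>i. \<integral>x. g i x \<partial>\<nu>) \<longlonglongrightarrow> (\<integral>x. f x \<partial>\<nu>)"
  proof (rule LIMSEQ_I)
    fix e :: real assume "e > 0"
    then have "e / 2 > 0" by simp
    then obtain N where N: "\<And>i j. i \<ge> N \<Longrightarrow> j \<ge> N \<Longrightarrow> (\<integral>x. \<bar>u i x - u j x\<bar> \<partial>\<nu>) < e / 2"
      using Cauchy_L1 by blast
    have "norm ((\<integral>x. g i x \<partial>\<nu>) - (\<integral>x. f x \<partial>\<nu>)) < e" if i: "i \<ge> N" for i
    proof -
      have "norm ((\<integral>x. g i x \<partial>\<nu>) - (\<integral>x. f x \<partial>\<nu>)) = \<bar>\<integral>x. g i x - f x \<partial>\<nu>\<bar>"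
        using admissible_integrable[OF f] admissible_integrable[OF g(1)]
        by (simp add: Bochner_Integration.integral_diff)
      also have "\<dots> \<le> (\<integral>x. \<bar>g i x - f x\<bar> \<partial>\<nu>)"
        by (rule integral_abs_bound)
      \<comment> \<open>Fatou's lemma in \<open>k\<close> with \<open>i\<close> fixed turns the
        Cauchy estimate into a distance to the limit.\<close>
      also have "\<dots> \<le> e / 2"
      proof (rule fatou_real(2))
        show "AE x in \<nu>. (\<lambda>k. \<bar>g i x - g k x\<bar>) \<longlonglongrightarrow> \<bar>g i x - f x\<bar>"
          using lim by eventually_elim (intro tendsto_intros)
        show "\<forall>\<^sub>F k in sequentially. (\<integral>x. \<bar>g i x - g k x\<bar> \<partial>\<nu>) \<le> e / 2"
          unfolding eventually_sequentially g_def
          using N seq_suble[OF r(1)] i by (meson less_imp_le order_trans)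
      qed (use admissible_integrable[OF g(1)] in auto)
      finally show ?thesis
        using \<open>e > 0\<close> by simp
    qed
    then show "\<exists>N. \<forall>i\<ge>N. norm ((\<integral>x. g i x \<partial>\<nu>) - (\<integral>x. f x \<partial>\<nu>)) < e"
      by blast
  qed
  \<comment> \<open>The energy of \<open>g i\<close> equals 2p times the sum of
    \<open>J (g i)\<close> and the integral of \<open>g i\<close>. The upper bound this gives
    converges by the choice of the sequence and by \<open>L1\<close>.\<close>
  have "(\<lambda>n. I + 1 / (real n + 1)) \<longlonglongrightarrow> I"
    by real_asymp
  then have "(\<lambda>n. I + 1 / (real (r n) + 1)) \<longlonglongrightarrow> I"
    by (rule LIMSEQ_subseq_LIMSEQ[OF _ r(1), unfolded o_def])
  then have "(\<lambda>i. 2 * p * ((I + 1 / (real (r i) + 1)) + (\<integral>x. g i x \<partial>\<nu>))) \<longlonglongrightarrow> 2 * p * (I + (\<integral>x. f x \<partial>\<nu>))"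
    by (intro tendsto_intros L1)
  moreover have energy_le: "energy (g i) \<le> 2 * p * ((I + 1 / (real (r i) + 1)) + (\<integral>x. g i x \<partial>\<nu>))" for i
  proof -
    have "energy (g i) = 2 * p * (J (g i) + (\<integral>x. g i x \<partial>\<nu>))"
      using p_gt_1 by (simp add: J_def)
    also have "\<dots> \<le> 2 * p * ((I + 1 / (real (r i) + 1)) + (\<integral>x. g i x \<partial>\<nu>))"
      using u(2)[of "r i"] p_gt_1 by (intro mult_left_mono) (auto simp: g_def)
    finally show ?thesis .
  qed
  ultimately have ev: "\<forall>\<^sub>F i in sequentially. energy (g i) \<le> 2 * p * (I + (\<integral>x. f x \<partial>\<nu>)) + e" if "e > 0" for e
    using that by (intro eventually_mono[OF order_tendstoD(2), of _ "2 * p * (I + (\<integral>x. f x \<partial>\<nu>))"])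
      (auto intro: order_trans less_imp_le)
  have "energy f \<le> 2 * p * (I + (\<integral>x. f x \<partial>\<nu>))"
  \<comment> \<open>\<open>fatou_real\<close> asks for a fixed bound, whereas the bounds on the
    energies only converge; the slack \<open>e\<close> bridges this.\<close>
  proof (rule field_le_epsilon)
    fix e :: real assume "e > 0"
    show "energy f \<le> 2 * p * (I + (\<integral>x. f x \<partial>\<nu>)) + e"
      unfolding energy_def
    proof (rule fatou_real(2))
      show "AE z in \<mu>. (\<lambda>i. \<bar>grad (g i) z\<bar> powr p) \<longlonglongrightarrow> \<bar>grad f z\<bar> powr p"
        using AE_fst[OF lim] AE_snd[OF lim]
        by eventually_elim (use p_gt_1 in \<open>intro tendsto_powr' tendsto_intros, auto\<close>)
      show "\<forall>\<^sub>F i in sequentially. (\<integral>z. \<bar>grad (g i) z\<bar> powr p \<partial>\<mu>) \<le> 2 * p * (I + (\<integral>x. f x \<partial>\<nu>)) + e"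
        using ev[OF \<open>e > 0\<close>] by (simp add: energy_def)
    qed (use integrable_grad_powr[OF g(1)] in auto)
  qed
  then have "J f \<le> I"
    using p_gt_1 by (simp add: J_def field_simps)
  with f I show ?thesis
    by (meson order_trans)
qed

lemma ex_nonneg_minimizer:
  "\<exists>f. admissible f \<and> (\<forall>x. 0 \<le> f x) \<and> (\<forall>g. admissible g \<longrightarrow> J f \<le> J g)"
proof -
  obtain f where f: "admissible f" "\<And>g. admissible g \<Longrightarrow> J f \<le> J g"
    using ex_minimizer by blast
  let ?f = "\<lambda>x. \<bar>f x\<bar>"
  \<comment> \<open>Reverse triangle inequality for the gradients.\<close>
  have "energy ?f \<le> energy f"
    unfolding energy_def
    using integrable_grad_powr[OF f(1)] integrable_grad_powr[OF admissible_abs[OF f(1)]] p_gt_1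
    by (intro integral_mono powr_mono2) auto
  then have "energy ?f / (2 * p) \<le> energy f / (2 * p)"
    using p_gt_1 by (intro divide_right_mono) auto
  moreover have "(\<integral>x. f x \<partial>\<nu>) \<le> (\<integral>x. \<bar>f x\<bar> \<partial>\<nu>)"
    using admissible_integrable[OF f(1)] by (intro integral_mono) auto
  ultimately have "J ?f \<le> J f"
    by (simp add: J_def)
  with f show ?thesis
    by (intro exI[of _ ?f]) (auto intro: admissible_abs order_trans)
qed

text \<open>
  The tangent at \<open>\<nabla>f + t\<nabla>h\<close> (rather than at \<open>\<nabla>f\<close>) bounds the difference quotient of the energy
  from above, so dominated convergence is applied to a continuous integrand as \<open>t \<rightarrow> 0\<close>.
\<close>

lemma minimizer_variational_le:
  assumes f: "admissible f" and min: "\<And>g. admissible g \<Longrightarrow> J f \<le> J g" and h: "admissible h"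
  shows "2 * (\<integral>x. h x \<partial>\<nu>) \<le> (\<integral>z. psi p (grad f z) * grad h z \<partial>\<mu>)"
proof -
  define t where "t n = 1 / (real n + 1)" for n
  have t: "t n > 0" "t n \<le> 1" for n
    by (auto simp: t_def)
  define F where "F n z = psi p (grad f z + t n * grad h z) * grad h z" for n z
  note [measurable] = grad_measurable[OF f] grad_measurable[OF h]
  have F_meas [measurable]: "F n \<in> borel_measurable \<mu>" for n
    unfolding F_def by measurable
  \<comment> \<open>Majorant from \<open>young_powr\<close> for the product of
    \<open>psi p (grad f z + t n * grad h z)\<close> and \<open>grad h z\<close>;
    \<open>t n \<le> 1\<close> makes it independent of n.\<close>
  let ?w = "\<lambda>z. 2 powr p * (\<bar>grad f z\<bar> powr p + \<bar>grad h z\<bar> powr p) + \<bar>grad h z\<bar> powr p"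
  have w: "integrable \<mu> ?w"
    using integrable_grad_powr[OF f] integrable_grad_powr[OF h] by auto
  have bound: "norm (F n z) \<le> ?w z" for n z
  proof -
    have "\<bar>grad f z + t n * grad h z\<bar> powr p \<le> (\<bar>grad f z\<bar> + \<bar>grad h z\<bar>) powr p"
    proof (rule powr_mono2)
      have "\<bar>t n * grad h z\<bar> \<le> \<bar>grad h z\<bar>"
        unfolding abs_mult using t[of n] by (intro mult_left_le_one_le) auto
      then show "\<bar>grad f z + t n * grad h z\<bar> \<le> \<bar>grad f z\<bar> + \<bar>grad h z\<bar>"
        by (rule order_trans[OF abs_triangle_ineq add_left_mono])
    qed (use p_gt_1 in auto)
    also have "\<dots> \<le> 2 powr p * (\<bar>grad f z\<bar> powr p + \<bar>grad h z\<bar> powr p)"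
      using p_gt_1 by (intro abs_add_powr_le) auto
    finally show ?thesis
      using young_powr[OF p_gt_1, of "grad f z + t n * grad h z" "grad h z"] by (simp add: F_def)
  qed
  have F_int: "integrable \<mu> (F n)" for n
    by (rule Bochner_Integration.integrable_bound[OF w F_meas])
      (intro AE_I2 order_trans[OF bound], simp)
  have lower: "2 * (\<integral>x. h x \<partial>\<nu>) \<le> (\<integral>z. F n z \<partial>\<mu>)" for n
  proof -
    let ?g = "\<lambda>x. f x + t n * h x"
    have g: "admissible ?g"
      using admissible_lincomb[OF f h, of 1 "t n"] by simp
    have grad_g: "grad ?g z = grad f z + t n * grad h z" for z
      by (simp add: algebra_simps)
    have "energy ?g - p * t n * (\<integral>z. F n z \<partial>\<mu>) = (\<integral>z. \<bar>grad ?g z\<bar> powr p - p * t n * F n z \<partial>\<mu>)"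
      using integrable_grad_powr[OF g] F_int[of n]
      by (simp add: energy_def Bochner_Integration.integral_diff)
    also have "\<dots> \<le> energy f"
      unfolding energy_def
    proof (rule integral_mono)
      fix z
      show "\<bar>grad ?g z\<bar> powr p - p * t n * F n z \<le> \<bar>grad f z\<bar> powr p"
        using abs_powr_above_tangent[OF p_gt_1, of "grad f z + t n * grad h z" "grad f z"]
        unfolding grad_g F_def by (simp add: mult_ac)
    qed (use integrable_grad_powr[OF g] integrable_grad_powr[OF f] F_int[of n] in auto)
    finally have 1: "energy ?g - energy f \<le> p * t n * (\<integral>z. F n z \<partial>\<mu>)"
      by simp
    \<comment> \<open>Minimality bounds the same energy increment from below; dividing by
      \<open>p * t n\<close> removes the step size.\<close>
    have "J f \<le> energy ?g / (2 * p) - ((\<integral>x. f x \<partial>\<nu>) + t n * (\<integral>x. h x \<partial>\<nu>))"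
      using min[OF g] admissible_integrable[OF f] admissible_integrable[OF h] by (simp add: J_def)
    then have "t n * (\<integral>x. h x \<partial>\<nu>) \<le> (energy ?g - energy f) / (2 * p)"
      by (simp add: J_def diff_divide_distrib)
    then have "2 * p * (t n * (\<integral>x. h x \<partial>\<nu>)) \<le> energy ?g - energy f"
      using p_gt_1 by (simp add: pos_le_divide_eq mult_ac)
    with 1 have "(p * t n) * (2 * (\<integral>x. h x \<partial>\<nu>)) \<le> (p * t n) * (\<integral>z. F n z \<partial>\<mu>)"
      by (simp add: mult_ac)
    then show ?thesis
      using t(1)[of n] p_gt_1 by (subst (asm) mult_le_cancel_left_pos) auto
  qed
  have "(\<lambda>n. \<integral>z. F n z \<partial>\<mu>) \<longlonglongrightarrow> (\<integral>z. psi p (grad f z) * grad h z \<partial>\<mu>)"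
  proof (rule integral_dominated_convergence[OF _ _ w])
    have "t \<longlonglongrightarrow> 0"
      unfolding t_def by real_asymp
    then have "(\<lambda>n. grad f z + t n * grad h z) \<longlonglongrightarrow> grad f z + 0 * grad h z" for z
      by (intro tendsto_add tendsto_mult tendsto_const)
    then have "(\<lambda>n. psi p (grad f z + t n * grad h z)) \<longlonglongrightarrow> psi p (grad f z)" for z
      by (intro continuous_on_tendsto_compose[OF continuous_on_psi[OF p_gt_1, of UNIV]]) simp_all
    then show "AE z in \<mu>. (\<lambda>n. F n z) \<longlonglongrightarrow> psi p (grad f z) * grad h z"
      unfolding F_def by (intro AE_I2 tendsto_intros)
  qed (use bound in auto)
  then show ?thesis
    by (rule LIMSEQ_le_const) (use lower in auto)
qed

section \<open>Weak solutions and their Rayleigh quotient\<close>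

definition weak_solution :: "('a \<Rightarrow> real) \<Rightarrow> bool" where
  "weak_solution f \<longleftrightarrow> admissible f \<and>
    (\<forall>h. admissible h \<longrightarrow> - (\<integral>z. psi p (grad f z) * h (fst z) \<partial>\<mu>) = (\<integral>x. h x \<partial>\<nu>))"

lemma ex_weak_solution: "\<exists>f. weak_solution f \<and> (\<forall>x. 0 \<le> f x)"
proof -
  obtain f where f: "admissible f" "\<And>x. 0 \<le> f x" "\<And>g. admissible g \<Longrightarrow> J f \<le> J g"
    using ex_nonneg_minimizer by blast
  have "- (\<integral>z. psi p (grad f z) * h (fst z) \<partial>\<mu>) = (\<integral>x. h x \<partial>\<nu>)" if h: "admissible h" for h
  proof -
    have le: "(\<integral>x. k x \<partial>\<nu>) \<le> - (\<integral>z. psi p (grad f z) * k (fst z) \<partial>\<mu>)" if "admissible k" for k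
      using minimizer_variational_le[OF f(1) f(3) that] integral_by_parts[OF f(1) that] by simp
    \<comment> \<open>The admissible functions form a linear space, so applying the inequality to h
      and to -h gives equality.\<close>
    have "admissible (\<lambda>x. - h x)"
      using admissible_lincomb[OF h h, of "- 1" 0] by simp
    from le[OF this] le[OF h] show ?thesis
      by simp
  qed
  with f show ?thesis
    by (auto simp: weak_solution_def)
qed

lemma weak_solution_energy:
  assumes "weak_solution f"
  shows "energy f = 2 * (\<integral>x. f x \<partial>\<nu>)"
proof -
  have f: "admissible f" and eq: "- (\<integral>z. psi p (grad f z) * f (fst z) \<partial>\<mu>) = (\<integral>x. f x \<partial>\<nu>)"
    using assms by (auto simp: weak_solution_def)
  have "energy f = (\<integral>z. psi p (grad f z) * grad f z \<partial>\<mu>)"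
    by (simp add: energy_def psi_mult_self)
  with integral_by_parts[OF f f] eq show ?thesis
    by simp
qed

text \<open>For f = 0 almost everywhere, testing the equation with the indicator of
  \<open>\<Omega>\<close> would give 0 = \<nu>(\<Omega>).\<close>

lemma weak_solution_not_AE_zero:
  assumes f: "weak_solution f" and pos: "emeasure \<nu> \<Omega> > 0"
  shows "\<not> (AE x in \<nu>. f x = 0)"
proof
  assume zero: "AE x in \<nu>. f x = 0"
  have "admissible (indicator \<Omega>)"
    by (intro admissible_indicator) auto
  with f have eq: "- (\<integral>z. psi p (grad f z) * indicator \<Omega> (fst z) \<partial>\<mu>) = (\<integral>x. indicator \<Omega> x \<partial>\<nu>)"
    unfolding weak_solution_def by blast
  have "AE z in \<mu>. psi p (grad f z) * indicator \<Omega> (fst z) = 0"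
    using AE_fst[OF zero] AE_snd[OF zero] by eventually_elim (simp add: psi_def)
  then have "(\<integral>z. psi p (grad f z) * indicator \<Omega> (fst z) \<partial>\<mu>) = 0"
    by (rule integral_eq_zero_AE)
  with eq have "measure \<nu> \<Omega> = 0"
    by simp
  with pos Omega_finite show False
    by (auto simp: measure_def enn2real_eq_0_iff)
qed

lemma weak_solution_rayleigh:
  assumes f: "weak_solution f" and pos: "emeasure \<nu> \<Omega> > 0"
  shows "0 < (\<integral>x. \<bar>f x\<bar> powr p \<partial>\<nu>)"
    and "energy f / 2 / (\<integral>x. \<bar>f x\<bar> powr p \<partial>\<nu>) \<le> measure \<nu> \<Omega> powr (p - 1) / (\<integral>x. f x \<partial>\<nu>) powr (p - 1)"
proof -
  have adm: "admissible f"
    using f by (simp add: weak_solution_def)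
  let ?P = "\<integral>x. \<bar>f x\<bar> powr p \<partial>\<nu>" and ?S = "\<integral>x. f x \<partial>\<nu>" and ?V = "measure \<nu> \<Omega>"
  have "?P \<noteq> 0"
    using weak_solution_not_AE_zero[OF f pos] p_gt_1
    by (subst integral_nonneg_eq_0_iff_AE[OF admissible_integrable_powr[OF adm]]) auto
  then show P: "0 < ?P"
    by (simp add: less_le)
  \<comment> \<open>The Poincare inequality and the energy identity force \<open>?S\<close> to be
    positive, so that dividing by its power is meaningful.\<close>
  have "0 < c * ?P"
    using c_pos P by simp
  also have "\<dots> \<le> 2 * ?S"
    using energy_ge[OF adm] weak_solution_energy[OF f] by simp
  finally have S: "0 < ?S"
    by simp
  have V: "0 < ?V"
    using pos Omega_finite by (simp add: measure_def enn2real_positive_iff)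
  \<comment> \<open>Jensen's inequality by hand: the tangent of the p-th power is taken at the mean
    value \<open>k\<close>, where its linear part integrates to 0.\<close>
  define k where "k = ?S / ?V"
  have k: "0 < k"
    using S V by (simp add: k_def)
  have "k powr p * ?V + p * psi p k * (?S - k * ?V) =
      (\<integral>x. k powr p * indicator \<Omega> x + p * psi p k * (f x - k * indicator \<Omega> x) \<partial>\<nu>)"
    using admissible_integrable[OF adm] integrable_indicator_Omega
    by (simp add: Bochner_Integration.integral_add Bochner_Integration.integral_diff)
  also have "\<dots> \<le> ?P"
  proof (rule integral_mono)
    fix x
    show "k powr p * indicator \<Omega> x + p * psi p k * (f x - k * indicator \<Omega> x) \<le> \<bar>f x\<bar> powr p"
      using abs_powr_above_tangent[OF p_gt_1, of k "f x"] k admissible_outside[OF adm, of x]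
      by (cases "x \<in> \<Omega>") auto
  qed (use admissible_integrable[OF adm] integrable_indicator_Omega admissible_integrable_powr[OF adm] in auto)
  also have "?S - k * ?V = 0"
    using V by (simp add: k_def)
  finally have "k powr p * ?V \<le> ?P"
    by simp
  moreover have "?S * ?S powr (p - 1) = ?S powr p" "?V * ?V powr (p - 1) = ?V powr p"
    using S V by (simp_all add: powr_mult_base)
  moreover have "k powr p = ?S powr p / ?V powr p"
    using S V by (simp add: k_def powr_divide)
  ultimately have "?S * ?S powr (p - 1) / (?V * ?V powr (p - 1)) * ?V \<le> ?P"
    by simp
  then have "?S * ?S powr (p - 1) \<le> ?P * ?V powr (p - 1)"
    using V by (simp add: field_simps)
  then show "energy f / 2 / ?P \<le> ?V powr (p - 1) / ?S powr (p - 1)"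
    using P S V by (simp add: weak_solution_energy[OF f] field_simps)
qed

end

section \<open>Reversible random walks\<close>

text \<open>The integrand depends on x as well as the measure. Pushing \<open>L x\<close> forward
  along y \<mapsto> (x, y) moves all dependence on x into the kernel.\<close>

lemma integral_measurable_subprob_algebra2:
  fixes f :: "'a \<Rightarrow> 'b \<Rightarrow> real"
  assumes f [measurable]: "(\<lambda>(x, y). f x y) \<in> borel_measurable (M \<Otimes>\<^sub>M N)"
    and L [measurable]: "L \<in> M \<rightarrow>\<^sub>M subprob_algebra N"
  shows "(\<lambda>x. \<integral>y. f x y \<partial>L x) \<in> borel_measurable M"
proof -
  note measurable_distr2 [measurable]
  have "(\<lambda>x. \<integral>z. (\<lambda>(x, y). f x y) z \<partial>distr (L x) (M \<Otimes>\<^sub>M N) (\<lambda>y. (x, y))) \<in> borel_measurable M"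
    by measurable
  then show ?thesis
    by (rule measurable_cong[THEN iffD1, rotated]) (simp add: integral_distr)
qed

text \<open>Nonemptiness is recorded because \<open>bind\<close> over an empty space is a degenerate
  measure with the wrong sigma-algebra.\<close>

locale reversible_walk =
  fixes \<nu> :: "'a measure" and m :: "'a \<Rightarrow> 'a measure"
  assumes reversible: "reversible_random_walk_space \<nu> m"
    and space_nonempty: "space \<nu> \<noteq> {}"
begin

abbreviation W :: "('a \<times> 'a) measure" where
  "W \<equiv> walk_measure \<nu> m"

section \<open>Integration against the walk measure\<close>

lemma walk_prob: "m \<in> \<nu> \<rightarrow>\<^sub>M prob_algebra \<nu>"
  using reversible by (simp add: reversible_random_walk_space_def random_walk_def)

lemma walk_subprob [measurable]: "m \<in> \<nu> \<rightarrow>\<^sub>M subprob_algebra \<nu>"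
  by (rule measurable_prob_algebraD[OF walk_prob])

lemma walk_kernel: "(\<lambda>x. m x \<bind> (\<lambda>y. return (\<nu> \<Otimes>\<^sub>M \<nu>) (x, y))) \<in> \<nu> \<rightarrow>\<^sub>M subprob_algebra (\<nu> \<Otimes>\<^sub>M \<nu>)"
  by (rule measurable_bind[OF walk_subprob]) measurable

lemma sets_W [measurable_cong]: "sets W = sets (\<nu> \<Otimes>\<^sub>M \<nu>)"
  unfolding walk_measure_def
  by (rule sets_bind[OF sets_kernel[OF walk_kernel] space_nonempty])

lemma walk_at:
  assumes "x \<in> space \<nu>"
  shows "prob_space (m x)" "sets (m x) = sets \<nu>" "space (m x) = space \<nu>"
  using measurable_space[OF walk_prob assms] by (auto simp: space_prob_algebra dest: sets_eq_imp_space_eq)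

lemma nn_integral_W:
  assumes F [measurable]: "F \<in> borel_measurable (\<nu> \<Otimes>\<^sub>M \<nu>)"
  shows "(\<integral>\<^sup>+z. F z \<partial>W) = (\<integral>\<^sup>+x. \<integral>\<^sup>+y. F (x, y) \<partial>m x \<partial>\<nu>)"
  unfolding walk_measure_def
proof (subst nn_integral_bind[OF F walk_kernel], rule nn_integral_cong)
  fix x assume x: "x \<in> space \<nu>"
  have "(\<lambda>y. return (\<nu> \<Otimes>\<^sub>M \<nu>) (x, y)) \<in> \<nu> \<rightarrow>\<^sub>M subprob_algebra (\<nu> \<Otimes>\<^sub>M \<nu>)"
    using x by measurable
  then have r: "(\<lambda>y. return (\<nu> \<Otimes>\<^sub>M \<nu>) (x, y)) \<in> m x \<rightarrow>\<^sub>M subprob_algebra (\<nu> \<Otimes>\<^sub>M \<nu>)"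
    by (simp add: measurable_cong_sets[OF walk_at(2)[OF x] refl])
  show "(\<integral>\<^sup>+z. F z \<partial>(m x \<bind> (\<lambda>y. return (\<nu> \<Otimes>\<^sub>M \<nu>) (x, y)))) = (\<integral>\<^sup>+y. F (x, y) \<partial>m x)"
    using x walk_at(3)[OF x] F
    by (subst nn_integral_bind[OF F r], intro nn_integral_cong, subst nn_integral_return)
      (auto simp: space_pair_measure)
qed

lemma nn_integral_W_swap:
  assumes [measurable]: "F \<in> borel_measurable (\<nu> \<Otimes>\<^sub>M \<nu>)"
  shows "(\<integral>\<^sup>+z. F (snd z, fst z) \<partial>W) = (\<integral>\<^sup>+z. F z \<partial>W)"
proof -
  have "distr W (\<nu> \<Otimes>\<^sub>M \<nu>) (\<lambda>(x, y). (y, x)) = W"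
    using reversible by (simp add: reversible_random_walk_space_def)
  then have "(\<integral>\<^sup>+z. F z \<partial>W) = (\<integral>\<^sup>+z. F z \<partial>distr W (\<nu> \<Otimes>\<^sub>M \<nu>) (\<lambda>(x, y). (y, x)))"
    by simp
  also have "\<dots> = (\<integral>\<^sup>+z. F (snd z, fst z) \<partial>W)"
    by (subst nn_integral_distr) (auto simp: case_prod_beta)
  finally show ?thesis ..
qed

lemma nn_integral_W_fst:
  assumes [measurable]: "g \<in> borel_measurable \<nu>"
  shows "(\<integral>\<^sup>+z. g (fst z) \<partial>W) = (\<integral>\<^sup>+x. g x \<partial>\<nu>)"
proof (subst nn_integral_W, measurable, rule nn_integral_cong)
  fix x assume "x \<in> space \<nu>"
  then show "(\<integral>\<^sup>+y. g (fst (x, y)) \<partial>m x) = g x"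
    using prob_space.emeasure_space_1[OF walk_at(1)[of x]] by simp
qed

text \<open>Reversibility makes \<open>\<nu>\<close> invariant: averaging \<open>m x N\<close> over
  \<open>\<nu>\<close> gives \<nu>(N). Hence a \<open>\<nu>\<close>-null set is null for
  \<open>m x\<close> at almost every x.\<close>

lemma AE_walk:
  assumes "AE x in \<nu>. P x"
  shows "AE x in \<nu>. AE y in m x. P y"
proof -
  from assms obtain N where N: "N \<in> null_sets \<nu>" "{x \<in> space \<nu>. \<not> P x} \<subseteq> N"
    by (auto elim!: AE_E)
  have [measurable]: "N \<in> sets \<nu>"
    using N by auto
  have "(\<integral>\<^sup>+x. emeasure (m x) N \<partial>\<nu>) = (\<integral>\<^sup>+x. \<integral>\<^sup>+y. indicator N (snd (x, y)) \<partial>m x \<partial>\<nu>)"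
    by (intro nn_integral_cong) (simp add: walk_at)
  also have "\<dots> = (\<integral>\<^sup>+z. indicator N (snd z) \<partial>W)"
    by (subst nn_integral_W) auto
  also have "\<dots> = (\<integral>\<^sup>+z. indicator N (fst z) \<partial>W)"
    by (subst nn_integral_W_swap[symmetric]) auto
  also have "\<dots> = 0"
    using N(1) by (simp add: nn_integral_W_fst null_setsD1)
  finally have zero: "AE x in \<nu>. emeasure (m x) N = 0"
    by (subst (asm) nn_integral_0_iff_AE) auto
  have P: "AE y in m x. P y" if x: "x \<in> space \<nu>" "emeasure (m x) N = 0" for x
  proof -
    have "N \<in> null_sets (m x)"
      using x by (auto simp: walk_at)
    then show ?thesis
      by (rule AE_I') (use N(2) x in \<open>auto simp: walk_at\<close>)
  qed
  show ?thesis
    by (rule AE_mp[OF zero], rule AE_I2) (use P in blast)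
qed

lemma integral_W_nonneg:
  fixes F :: "'a \<times> 'a \<Rightarrow> real"
  assumes int: "integrable W F" and F: "\<And>z. 0 \<le> F z"
  shows "AE x in \<nu>. integrable (m x) (\<lambda>y. F (x, y))"
    and "has_bochner_integral \<nu> (\<lambda>x. \<integral>y. F (x, y) \<partial>m x) (\<integral>z. F z \<partial>W)"
proof -
  have [measurable]: "F \<in> borel_measurable (\<nu> \<Otimes>\<^sub>M \<nu>)"
    using borel_measurable_integrable[OF int] by (simp add: measurable_cong_sets[OF sets_W refl])
  have [measurable]: "(\<lambda>x. \<integral>\<^sup>+y. ennreal (F (x, y)) \<partial>m x) \<in> borel_measurable \<nu>"
    by (rule nn_integral_measurable_subprob_algebra2[OF _ walk_subprob]) measurable
  have int_meas [measurable]: "(\<lambda>y. F (x, y)) \<in> borel_measurable (m x)" if "x \<in> space \<nu>" for x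
    unfolding measurable_cong_sets[OF walk_at(2)[OF that] refl] using that by measurable
  have eq: "(\<integral>\<^sup>+x. \<integral>\<^sup>+y. ennreal (F (x, y)) \<partial>m x \<partial>\<nu>) = ennreal (\<integral>z. F z \<partial>W)"
    using nn_integral_W[of "\<lambda>z. ennreal (F z)"] nn_integral_eq_integral[OF int] F by simp
  then have fin: "AE x in \<nu>. (\<integral>\<^sup>+y. ennreal (F (x, y)) \<partial>m x) \<noteq> \<infinity>"
    by (intro nn_integral_PInf_AE) auto
  have inner_int: "integrable (m x) (\<lambda>y. F (x, y))"
    if "x \<in> space \<nu>" "(\<integral>\<^sup>+y. ennreal (F (x, y)) \<partial>m x) \<noteq> \<infinity>" for x
    by (rule integrableI_nonneg[OF int_meas[OF that(1)]])
      (use that(2) in \<open>simp_all add: F less_top\<close>)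
  show ae: "AE x in \<nu>. integrable (m x) (\<lambda>y. F (x, y))"
    by (rule AE_mp[OF fin], rule AE_I2) (use inner_int in blast)
  have inner: "(\<integral>y. F (x, y) \<partial>m x) = enn2real (\<integral>\<^sup>+y. ennreal (F (x, y)) \<partial>m x)" if "x \<in> space \<nu>" for x
    using that F by (intro integral_eq_nn_integral) auto
  show "has_bochner_integral \<nu> (\<lambda>x. \<integral>y. F (x, y) \<partial>m x) (\<integral>z. F z \<partial>W)"
  proof (rule has_bochner_integral_nn_integral)
    show "(\<lambda>x. \<integral>y. F (x, y) \<partial>m x) \<in> borel_measurable \<nu>"
      by (subst measurable_cong[OF inner]) measurable
    have "(\<integral>\<^sup>+x. ennreal (\<integral>y. F (x, y) \<partial>m x) \<partial>\<nu>) = (\<integral>\<^sup>+x. \<integral>\<^sup>+y. ennreal (F (x, y)) \<partial>m x \<partial>\<nu>)"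
      using ae by (intro nn_integral_cong_AE, eventually_elim) (simp add: nn_integral_eq_integral F)
    with eq show "(\<integral>\<^sup>+x. ennreal (\<integral>y. F (x, y) \<partial>m x) \<partial>\<nu>) = ennreal (\<integral>z. F z \<partial>W)"
      by simp
  qed (auto simp: F)
qed

text \<open>Fubini's theorem for the kernel, from the nonnegative case applied to the positive and
  negative parts.\<close>

lemma integral_W:
  fixes F :: "'a \<times> 'a \<Rightarrow> real"
  assumes int: "integrable W F"
  shows "AE x in \<nu>. integrable (m x) (\<lambda>y. F (x, y))"
    and "has_bochner_integral \<nu> (\<lambda>x. \<integral>y. F (x, y) \<partial>m x) (\<integral>z. F z \<partial>W)"
proof -
  let ?P = "\<lambda>z. max 0 (F z)" and ?N = "\<lambda>z. max 0 (- F z)"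
  have PN: "integrable W ?P" "integrable W ?N"
    using int by auto
  note P = integral_W_nonneg[OF PN(1) max.cobounded1] and N = integral_W_nonneg[OF PN(2) max.cobounded1]
  have F_eq: "?P z - ?N z = F z" for z
    by simp
  have ae: "AE x in \<nu>. integrable (m x) (\<lambda>y. F (x, y)) \<and>
      (\<integral>y. ?P (x, y) \<partial>m x) - (\<integral>y. ?N (x, y) \<partial>m x) = (\<integral>y. F (x, y) \<partial>m x)"
    using P(1) N(1)
  proof eventually_elim
    case (elim x)
    then show ?case
      using Bochner_Integration.integrable_diff[OF elim] Bochner_Integration.integral_diff[OF elim]
      unfolding F_eq by simp
  qed
  then show "AE x in \<nu>. integrable (m x) (\<lambda>y. F (x, y))"
    by eventually_elim simp
  have bi: "has_bochner_integral \<nu> (\<lambda>x. (\<integral>y. ?P (x, y) \<partial>m x) - (\<integral>y. ?N (x, y) \<partial>m x)) (\<integral>z. F z \<partial>W)"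
    using has_bochner_integral_diff[OF P(2) N(2)]
    unfolding Bochner_Integration.integral_diff[OF PN, symmetric] F_eq .
  have [measurable]: "F \<in> borel_measurable (\<nu> \<Otimes>\<^sub>M \<nu>)"
    using borel_measurable_integrable[OF int] by (simp add: measurable_cong_sets[OF sets_W refl])
  \<comment> \<open>The inner integral is known to be the difference of those of the parts only
    almost everywhere, so its measurability is shown directly.\<close>
  have "(\<lambda>x. \<integral>y. F (x, y) \<partial>m x) \<in> borel_measurable \<nu>"
    by (rule integral_measurable_subprob_algebra2[OF _ walk_subprob]) measurable
  moreover have "AE x in \<nu>. (\<integral>y. ?P (x, y) \<partial>m x) - (\<integral>y. ?N (x, y) \<partial>m x) = (\<integral>y. F (x, y) \<partial>m x)"
    using ae by eventually_elim simp
  ultimately show "has_bochner_integral \<nu> (\<lambda>x. \<integral>y. F (x, y) \<partial>m x) (\<integral>z. F z \<partial>W)"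
    using bi has_bochner_integral_cong_AE[of "\<lambda>x. (\<integral>y. ?P (x, y) \<partial>m x) - (\<integral>y. ?N (x, y) \<partial>m x)" \<nu>
        "\<lambda>x. \<integral>y. F (x, y) \<partial>m x"] borel_measurable_has_bochner_integral[OF bi] by blast
qed

end

locale torsion_domain = reversible_walk \<nu> m
  for \<nu> :: "'a measure" and m :: "'a \<Rightarrow> 'a measure" +
  fixes \<Omega> :: "'a set" and p c :: real
  assumes p_gt_1: "p > 1"
    and Omega [measurable]: "\<Omega> \<in> sets \<nu>"
    and Omega_pos: "emeasure \<nu> \<Omega> > 0"
    and closure_finite: "emeasure \<nu> (m_closure \<nu> m \<Omega>) < \<infinity>"
    and c_pos: "c > 0"
    and poincare: "\<And>f. f \<in> Lp0 \<nu> m p \<Omega> \<Longrightarrow>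
      ennreal c * (\<integral>\<^sup>+x\<in>\<Omega>. ennreal (\<bar>f x\<bar> powr p) \<partial>\<nu>) \<le> gradient_energy \<nu> m p \<Omega> f"
begin

abbreviation Om :: "'a set" where
  "Om \<equiv> m_closure \<nu> m \<Omega>"

text \<open>Restriction is encoded as a density, which keeps the sigma-algebra of the full product,
  as \<open>torsion_problem\<close> requires.\<close>

definition \<mu> :: "('a \<times> 'a) measure" where
  "\<mu> = density W (\<lambda>z. ennreal (indicator (Om \<times> Om) z))"

lemma boundary_measurable [measurable]: "m_boundary \<nu> m \<Omega> \<in> sets \<nu>"
proof -
  have "m_boundary \<nu> m \<Omega> = {x \<in> space \<nu>. emeasure (m x) \<Omega> > 0} - \<Omega>"
    by (auto simp: m_boundary_def)
  also have "\<dots> \<in> sets \<nu>"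
    by measurable
  finally show ?thesis .
qed

lemma closure_measurable [measurable]: "Om \<in> sets \<nu>"
  unfolding m_closure_def by measurable

lemma Omega_subset: "\<Omega> \<subseteq> Om"
  by (auto simp: m_closure_def)

lemma sets_mu [measurable_cong]: "sets \<mu> = sets (\<nu> \<Otimes>\<^sub>M \<nu>)"
  by (simp add: \<mu>_def sets_W)

lemma nn_integral_mu:
  assumes [measurable]: "F \<in> borel_measurable (\<nu> \<Otimes>\<^sub>M \<nu>)"
  shows "(\<integral>\<^sup>+z. F z \<partial>\<mu>) = (\<integral>\<^sup>+z\<in>Om \<times> Om. F z \<partial>W)"
  unfolding \<mu>_def by (subst nn_integral_density) (auto simp: mult.commute ennreal_indicator)

text \<open>The square \<open>Om \<times> Om\<close> is invariant under exchanging the coordinates,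
  so its restriction inherits the reversibility of \<open>W\<close>.\<close>

lemma mu_symmetric: "distr \<mu> \<mu> (\<lambda>z. (snd z, fst z)) = \<mu>"
proof (rule measure_eqI)
  fix A assume "A \<in> sets (distr \<mu> \<mu> (\<lambda>z. (snd z, fst z)))"
  then have [measurable]: "A \<in> sets (\<nu> \<Otimes>\<^sub>M \<nu>)"
    by (simp add: sets_mu)
  have sw [measurable]: "(\<lambda>z. (snd z, fst z)) \<in> \<mu> \<rightarrow>\<^sub>M \<mu>"
    unfolding measurable_cong_sets[OF sets_mu sets_mu] by measurable
  have "emeasure (distr \<mu> \<mu> (\<lambda>z. (snd z, fst z))) A = (\<integral>\<^sup>+z. indicator A z \<partial>distr \<mu> \<mu> (\<lambda>z. (snd z, fst z)))"
    by (simp add: sets_mu)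
  also have "\<dots> = (\<integral>\<^sup>+z. indicator A (snd z, fst z) \<partial>\<mu>)"
    by (subst nn_integral_distr) auto
  also have "\<dots> = (\<integral>\<^sup>+z\<in>Om \<times> Om. indicator A (snd z, fst z) \<partial>W)"
    by (rule nn_integral_mu) measurable
  also have "\<dots> = (\<integral>\<^sup>+z. (\<lambda>z. indicator A z * indicator (Om \<times> Om) z) (snd z, fst z) \<partial>W)"
    by (intro nn_integral_cong) (auto simp: indicator_def)
  also have "\<dots> = (\<integral>\<^sup>+z\<in>Om \<times> Om. indicator A z \<partial>W)"
    by (rule nn_integral_W_swap) measurable
  also have "\<dots> = (\<integral>\<^sup>+z. indicator A z \<partial>\<mu>)"
    by (rule nn_integral_mu[symmetric]) measurable
  also have "\<dots> = emeasure \<mu> A"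
    by (simp add: sets_mu)
  finally show "emeasure (distr \<mu> \<mu> (\<lambda>z. (snd z, fst z))) A = emeasure \<mu> A" .
qed simp

lemma zero_outside_in_Lp0:
  assumes [measurable]: "f \<in> borel_measurable \<nu>" and int: "integrable \<nu> (\<lambda>x. \<bar>f x\<bar> powr p)"
    and out: "\<And>x. x \<notin> \<Omega> \<Longrightarrow> f x = 0"
  shows "f \<in> Lp0 \<nu> m p \<Omega>"
proof -
  have "set_integrable \<nu> Om (\<lambda>x. \<bar>f x\<bar> powr p)"
    unfolding set_integrable_def using int by (rule integrable_mult_indicator[rotated]) measurable
  moreover have "set_borel_measurable \<nu> Om f"
    unfolding set_borel_measurable_def by measurable
  ultimately show ?thesis
    using out by (auto simp: Lp0_def Lp_on_def m_boundary_def)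
qed

lemma gradient_energy_eq:
  assumes [measurable]: "f \<in> borel_measurable \<nu>"
  shows "gradient_energy \<nu> m p \<Omega> f = (\<integral>\<^sup>+z. ennreal (\<bar>f (snd z) - f (fst z)\<bar> powr p) \<partial>\<mu>)"
  unfolding gradient_energy_def by (rule nn_integral_mu[symmetric]) measurable

lemma nn_integral_Omega:
  assumes "\<And>x. x \<notin> \<Omega> \<Longrightarrow> f x = 0"
  shows "(\<integral>\<^sup>+x\<in>\<Omega>. ennreal (\<bar>f x\<bar> powr p) \<partial>\<nu>) = (\<integral>\<^sup>+x. ennreal (\<bar>f x\<bar> powr p) \<partial>\<nu>)"
  using assms by (intro nn_integral_cong) (auto simp: indicator_def)

sublocale torsion_problem \<nu> \<mu> \<Omega> p c
proof
  show "emeasure \<nu> \<Omega> < \<infinity>"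
    using emeasure_mono[OF Omega_subset closure_measurable] closure_finite by (rule le_less_trans)
next
  fix g :: "'a \<Rightarrow> ennreal" assume [measurable]: "g \<in> borel_measurable \<nu>"
  \<comment> \<open>The first marginal of \<open>W\<close> is \<open>\<nu>\<close>; restricting to
    \<open>Om \<times> Om\<close> can only lose mass.\<close>
  have "(\<integral>\<^sup>+z. g (fst z) \<partial>\<mu>) \<le> (\<integral>\<^sup>+z. g (fst z) \<partial>W)"
    by (subst nn_integral_mu) (auto intro!: nn_integral_mono simp: indicator_def)
  then show "(\<integral>\<^sup>+z. g (fst z) \<partial>\<mu>) \<le> (\<integral>\<^sup>+x. g x \<partial>\<nu>)"
    by (simp add: nn_integral_W_fst)
next
  fix f :: "'a \<Rightarrow> real"
  assume f: "f \<in> borel_measurable \<nu>" "integrable \<nu> (\<lambda>x. \<bar>f x\<bar> powr p)" "\<And>x. x \<notin> \<Omega> \<Longrightarrow> f x = 0"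
  show "ennreal c * (\<integral>\<^sup>+x. ennreal (\<bar>f x\<bar> powr p) \<partial>\<nu>) \<le> (\<integral>\<^sup>+z. ennreal (\<bar>f (snd z) - f (fst z)\<bar> powr p) \<partial>\<mu>)"
    using poincare[OF zero_outside_in_Lp0[OF f]] gradient_energy_eq[OF f(1)] nn_integral_Omega[OF f(3)] by simp
qed (use p_gt_1 Omega sets_mu mu_symmetric c_pos in auto)

end

section \<open>The torsional function and the eigenvalue estimate\<close>

context torsion_domain begin

text \<open>The nonlocal p-Laplacian of f at x, with jumps confined to \<open>Om\<close>.\<close>

definition flux :: "('a \<Rightarrow> real) \<Rightarrow> 'a \<Rightarrow> real" where
  "flux f x = (LINT y:Om|m x. psi p (f y - f x))"

text \<open>Fubini's theorem links the weak form to the pointwise equation. As h vanishes outside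
  \<open>\<Omega>\<close>, the cutoff to \<open>Om\<close> in the first variable costs
  nothing.\<close>

lemma has_integral_flux:
  assumes f: "admissible f" and h: "admissible h"
  shows "has_bochner_integral \<nu> (\<lambda>x. h x * flux f x) (\<integral>z. psi p (grad f z) * h (fst z) \<partial>\<mu>)"
proof -
  note [measurable] = admissible_measurable[OF f] admissible_measurable[OF h]
  define F where "F z = indicator (Om \<times> Om) z * (psi p (grad f z) * h (fst z))" for z
  have "integrable W F" and eq: "(\<integral>z. F z \<partial>W) = (\<integral>z. psi p (grad f z) * h (fst z) \<partial>\<mu>)"
    using integrable_psi_grad_fst[OF f h] unfolding F_def \<mu>_def
    by (auto simp: integrable_density integral_density)
  then have "has_bochner_integral \<nu> (\<lambda>x. \<integral>y. F (x, y) \<partial>m x) (\<integral>z. psi p (grad f z) * h (fst z) \<partial>\<mu>)"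
    using integral_W(2)[of F] by simp
  moreover have "(\<integral>y. F (x, y) \<partial>m x) = h x * flux f x" for x
  proof -
    have "F (x, y) = h x * (indicator Om y *\<^sub>R psi p (f y - f x))" for y
      using admissible_outside[OF h, of x] Omega_subset by (cases "x \<in> Om") (auto simp: F_def indicator_def)
    then show ?thesis
      by (simp add: flux_def set_lebesgue_integral_def)
  qed
  ultimately show ?thesis
    by simp
qed

text \<open>Indicators of measurable subsets of \<open>\<Omega>\<close> are admissible tests, and a
  function is determined almost everywhere by its integrals over measurable sets.\<close>

lemma weak_solution_flux:
  assumes f: "weak_solution f"
  shows "AE x in \<nu>. x \<in> \<Omega> \<longrightarrow> - flux f x = 1"
proof -
  have adm: "admissible f"
    and eq: "\<And>h. admissible h \<Longrightarrow> - (\<integral>z. psi p (grad f z) * h (fst z) \<partial>\<mu>) = (\<integral>x. h x \<partial>\<nu>)"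
    using f by (auto simp: weak_solution_def)
  have ind: "admissible (indicator (A \<inter> \<Omega>))" if "A \<in> sets \<nu>" for A
    using that by (intro admissible_indicator) auto
  have "AE x in \<nu>. indicator \<Omega> x * flux f x = - indicator \<Omega> x"
  proof (rule density_unique_real)
    show "integrable \<nu> (\<lambda>x. indicator \<Omega> x * flux f x)"
      using has_integral_flux[OF adm ind[OF Omega]] by (simp add: has_bochner_integral_iff)
    show "integrable \<nu> (\<lambda>x. - indicator \<Omega> x :: real)"
      using integrable_indicator_Omega by simp
    fix A assume A: "A \<in> sets \<nu>"
    have "(\<integral>x\<in>A. indicator \<Omega> x * flux f x \<partial>\<nu>) = (\<integral>x. indicator (A \<inter> \<Omega>) x * flux f x \<partial>\<nu>)"
      by (simp add: set_lebesgue_integral_def indicator_inter_arith mult.assoc)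
    also have "\<dots> = - (\<integral>x. indicator (A \<inter> \<Omega>) x \<partial>\<nu>)"
      using has_integral_flux[OF adm ind[OF A]] eq[OF ind[OF A]] by (simp add: has_bochner_integral_iff)
    also have "\<dots> = (\<integral>x. - indicator (A \<inter> \<Omega>) x \<partial>\<nu>)"
      by (rule integral_minus[symmetric])
    also have "\<dots> = (\<integral>x\<in>A. - indicator \<Omega> x \<partial>\<nu>)"
      by (simp add: set_lebesgue_integral_def indicator_inter_arith)
    finally show "(\<integral>x\<in>A. indicator \<Omega> x * flux f x \<partial>\<nu>) = (\<integral>x\<in>A. - indicator \<Omega> x \<partial>\<nu>)" .
  qed
  then show ?thesis
    by eventually_elim auto
qed

lemma ex_torsional: "\<exists>f. is_torsional \<nu> m p \<Omega> f"
proof -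
  obtain f where f: "weak_solution f" "\<And>x. 0 \<le> f x"
    using ex_weak_solution by blast
  then have "f \<in> Lp0 \<nu> m p \<Omega>"
    by (intro zero_outside_in_Lp0) (auto simp: weak_solution_def admissible_def)
  with f weak_solution_flux[OF f(1)] show ?thesis
    by (auto simp: is_torsional_def flux_def psi_def)
qed

text \<open>A torsional function may be arbitrary outside \<open>Om\<close> and nonzero on a null
  part of the boundary. Truncation to \<open>\<Omega>\<close> yields an admissible representative
  that solves the same equation.\<close>

lemma torsional_weak_solution:
  assumes g: "is_torsional \<nu> m p \<Omega> g"
  shows "weak_solution (\<lambda>x. indicator \<Omega> x * g x)"
proof -
  let ?f = "\<lambda>x. indicator \<Omega> x * g x" and ?g = "\<lambda>x. indicator Om x * g x"
  have "g \<in> Lp0 \<nu> m p \<Omega>"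
    using g by (simp add: is_torsional_def)
  then have g_meas [measurable]: "?g \<in> borel_measurable \<nu>"
    and g_int: "integrable \<nu> (\<lambda>x. indicator Om x * \<bar>g x\<bar> powr p)"
    and boundary: "AE x in \<nu>. x \<in> m_boundary \<nu> m \<Omega> \<longrightarrow> g x = 0"
    by (auto simp: Lp0_def Lp_on_def set_borel_measurable_def set_integrable_def)
  \<comment> \<open>Membership in \<open>Lp0\<close> provides measurability of \<open>?g\<close>
    only, so \<open>?f\<close> is expressed through it.\<close>
  have f_eq: "?f = (\<lambda>x. indicator \<Omega> x * ?g x)"
    using Omega_subset by (auto simp: indicator_def fun_eq_iff)
  have f_meas [measurable]: "?f \<in> borel_measurable \<nu>"
    unfolding f_eq by measurable
  have powr_eq: "(\<lambda>x. \<bar>?f x\<bar> powr p) = (\<lambda>x. indicator \<Omega> x *\<^sub>R (indicator Om x * \<bar>g x\<bar> powr p))"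
    using Omega_subset by (auto simp: indicator_def fun_eq_iff)
  have f: "admissible ?f"
    unfolding admissible_def powr_eq using integrable_mult_indicator[OF Omega g_int] f_meas by simp
  \<comment> \<open>\<open>?g\<close> and \<open>?f\<close> differ on a null part of the boundary;
    by \<open>AE_walk\<close> this leaves the integrals against \<open>m x\<close> unchanged for
    almost every x.\<close>
  have "AE x in \<nu>. ?g x = ?f x"
    using boundary by eventually_elim (auto simp: indicator_def m_closure_def)
  then have "AE x in \<nu>. AE y in m x. ?g y = ?f y"
    by (rule AE_walk)
  moreover have "AE x in \<nu>. x \<in> \<Omega> \<longrightarrow> - (LINT y:Om|m x. psi p (g y - g x)) = 1"
    using g by (simp add: is_torsional_def psi_def)
  moreover have "AE x in \<nu>. x \<in> space \<nu>"
    by simp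
  ultimately have flux: "AE x in \<nu>. x \<in> \<Omega> \<longrightarrow> flux ?f x = - 1"
  proof eventually_elim
    case (elim x)
    show ?case
    proof
      assume x: "x \<in> \<Omega>"
      have meas: "(\<lambda>y. indicator Om y * psi p (u y - ?f x)) \<in> borel_measurable (m x)"
        if [measurable]: "u \<in> borel_measurable \<nu>" for u :: "'a \<Rightarrow> real"
        unfolding measurable_cong_sets[OF walk_at(2)[OF elim(3)] refl] by measurable
      have "flux ?f x = (\<integral>y. indicator Om y * psi p (?f y - ?f x) \<partial>m x)"
        by (simp add: flux_def set_lebesgue_integral_def)
      also have "\<dots> = (\<integral>y. indicator Om y * psi p (?g y - ?f x) \<partial>m x)"
      proof (rule integral_cong_AE)
        show "AE y in m x. indicator Om y * psi p (?f y - ?f x) = indicator Om y * psi p (?g y - ?f x)"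
          using elim(1) by eventually_elim (simp only:)
      qed (rule meas[OF f_meas] meas[OF g_meas])+
      also have "\<dots> = (LINT y:Om|m x. psi p (g y - g x))"
        unfolding set_lebesgue_integral_def
        using x by (intro Bochner_Integration.integral_cong) (auto simp: indicator_def)
      also have "\<dots> = - 1"
        using elim(2) x by simp
      finally show "flux ?f x = - 1" .
    qed
  qed
  have "- (\<integral>z. psi p (grad ?f z) * h (fst z) \<partial>\<mu>) = (\<integral>x. h x \<partial>\<nu>)" if h: "admissible h" for h
  proof -
    note hb = has_integral_flux[OF f h]
    have "(\<integral>z. psi p (grad ?f z) * h (fst z) \<partial>\<mu>) = (\<integral>x. h x * flux ?f x \<partial>\<nu>)"
      using hb by (simp add: has_bochner_integral_iff)
    also have "\<dots> = (\<integral>x. - h x \<partial>\<nu>)"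
    proof (rule integral_cong_AE)
      show "(\<lambda>x. h x * flux ?f x) \<in> borel_measurable \<nu>"
        using hb by (auto simp: has_bochner_integral_iff)
      show "(\<lambda>x. - h x) \<in> borel_measurable \<nu>"
        using admissible_measurable[OF h] by measurable
      show "AE x in \<nu>. h x * flux ?f x = - h x"
        using flux by eventually_elim (use admissible_outside[OF h] in fastforce)
    qed
    finally show ?thesis
      by simp
  qed
  with f show ?thesis
    unfolding weak_solution_def by blast
qed

text \<open>Stated for an arbitrary torsional function, so that it applies to whichever one the
  choice operator selects. Its truncation to \<open>\<Omega>\<close> is the competitor in the
  infimum.\<close>

lemma eigenvalue_le_torsional:
  assumes g: "is_torsional \<nu> m p \<Omega> g"
  shows "dirichlet_eigenvalue \<nu> m p \<Omega>
    \<le> ennreal (measure \<nu> \<Omega> powr (p - 1) / (LINT x:\<Omega>|\<nu>. g x) powr (p - 1))"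
proof -
  let ?f = "\<lambda>x. indicator \<Omega> x * g x" and ?P = "\<integral>x. \<bar>indicator \<Omega> x * g x\<bar> powr p \<partial>\<nu>"
  have weak: "weak_solution ?f"
    by (rule torsional_weak_solution[OF g])
  then have f: "admissible ?f"
    by (simp add: weak_solution_def)
  have out: "\<And>x. x \<notin> \<Omega> \<Longrightarrow> ?f x = 0"
    by simp
  have "?f \<in> Lp0 \<nu> m p \<Omega>"
    by (rule zero_outside_in_Lp0[OF admissible_measurable[OF f] admissible_integrable_powr[OF f] out])
  moreover have "\<not> (AE x in \<nu>. x \<in> Om \<longrightarrow> ?f x = 0)"
  proof
    assume "AE x in \<nu>. x \<in> Om \<longrightarrow> ?f x = 0"
    then have "AE x in \<nu>. ?f x = 0"
      by eventually_elim (use Omega_subset in \<open>auto simp: indicator_def\<close>)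
    with weak_solution_not_AE_zero[OF weak Omega_pos] show False ..
  qed
  ultimately have "dirichlet_eigenvalue \<nu> m p \<Omega>
      \<le> (1 / 2 * gradient_energy \<nu> m p \<Omega> ?f) / (\<integral>\<^sup>+x\<in>\<Omega>. ennreal (\<bar>?f x\<bar> powr p) \<partial>\<nu>)"
    unfolding dirichlet_eigenvalue_def by (intro INF_lower) auto
  also have "(\<integral>\<^sup>+x\<in>\<Omega>. ennreal (\<bar>?f x\<bar> powr p) \<partial>\<nu>) = ennreal ?P"
    using nn_integral_Omega[of ?f] nn_integral_eq_integral[OF admissible_integrable_powr[OF f]]
    by simp
  also have "gradient_energy \<nu> m p \<Omega> ?f = ennreal (energy ?f)"
    unfolding gradient_energy_eq[OF admissible_measurable[OF f]] by (rule nn_integral_grad_powr[OF f])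
  also have "1 / 2 * ennreal (energy ?f) = ennreal (energy ?f / 2)"
    using energy_nonneg[of ?f] by (simp add: ennreal_divide_times divide_ennreal flip: ennreal_numeral)
  also have "ennreal (energy ?f / 2) / ennreal ?P = ennreal (energy ?f / 2 / ?P)"
    using energy_nonneg[of ?f] weak_solution_rayleigh(1)[OF weak Omega_pos] by (intro divide_ennreal) auto
  also have "\<dots> \<le> ennreal (measure \<nu> \<Omega> powr (p - 1) / (\<integral>x. ?f x \<partial>\<nu>) powr (p - 1))"
    by (intro ennreal_leI weak_solution_rayleigh(2)[OF weak Omega_pos])
  finally show ?thesis
    by (simp add: set_lebesgue_integral_def)
qed

end

theorem corollary6p5:
  fixes \<nu> :: "'a measure" and m :: "'a \<Rightarrow> 'a measure" and p :: real and \<Omega> :: "'a set"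
  assumes "p > 1"
    and "reversible_random_walk_space \<nu> m"
    and "\<Omega> \<in> sets \<nu>"
    and "m_connected \<nu> m \<Omega>"
    and "0 < emeasure \<nu> \<Omega>"
    and "emeasure \<nu> \<Omega> < emeasure \<nu> (m_closure \<nu> m \<Omega>)"
    and "emeasure \<nu> (m_closure \<nu> m \<Omega>) < \<infinity>"
    and "poincare_inequality \<nu> m p \<Omega>"
  shows "dirichlet_eigenvalue \<nu> m p \<Omega>
    \<le> ennreal (measure \<nu> \<Omega> powr (p - 1) / torsional_rigidity \<nu> m p \<Omega>)"
proof -
  obtain c where c: "c > 0" "\<And>f. f \<in> Lp0 \<nu> m p \<Omega> \<Longrightarrow>
      ennreal c * (\<integral>\<^sup>+x\<in>\<Omega>. ennreal (\<bar>f x\<bar> powr p) \<partial>\<nu>) \<le> gradient_energy \<nu> m p \<Omega> f"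
    using assms(8) by (auto simp: poincare_inequality_def)
  have "space \<nu> \<noteq> {}"
    using assms(3,5) sets.sets_into_space by fastforce
  then interpret torsion_domain \<nu> m \<Omega> p c
    using assms c by unfold_locales auto
  \<comment> \<open>Existence is what gives the chosen \<open>torsional_function\<close> its
    defining property.\<close>
  have "is_torsional \<nu> m p \<Omega> (torsional_function \<nu> m p \<Omega>)"
    unfolding torsional_function_def by (rule someI_ex[OF ex_torsional])
  then show ?thesis
    unfolding torsional_rigidity_def by (rule eigenvalue_le_torsional)
qed

end
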